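(* Let $v$ be a valuation on a field $F$ with valuation ring $O_v$, let $E/F$ be a finite field extension, let $R$ be a subring of $E$ with field of fractions $E$ satisfying $R\cap F=O_v$, and let $w$ be the filter quasi-valuation on $E$ induced by $(R,v)$ (so $R=O_w$). Then there exists a valuation $u$ of $E$ extending $v$ such that $O_u\supseteq O_w$. Moreover, every such $u$ dominates $w$: $w(x)\le u(x)$ for all $x\in E$.
   Context: Cut monoid. For a totally ordered abelian group $\Gamma$, a cut $\mathcal A=(\mathcal A^L,\mathcal A^R)$ is a partition of $\Gamma$ into two (possibly empty) subsets with $\alpha<\beta$ for all $\alpha\in\mathcal A^L,\beta\in\mathcal A^R$. $\mathcal M(\Gamma)$ is the set of all cuts, ordered by $\mathcal A\le\mathcal B$ iff $\mathcal A^L\subseteq\mathcal B^L$, with addition $(\mathcal A+\mathcal B)^L=\{\alpha+\beta\mid\alpha\in\mathcal A^L,\beta\in\mathcal B^L\}$; it is a totally ordered abelian monoid, and $a<b$ implies $na<nb$ for $n\in\mathbb N$. For $S\subseteq\Gamma$, $S^+$ is the smallest cut $\mathcal A$ with $S\subseteq\mathcal A^L$. $\Gamma$ embeds in $\mathcal M(\Gamma)$ via $\alpha\mapsto\{\alpha\}^+=((-\infty,\alpha],(\alpha,\infty))$; $\mathcal B-\alpha$ means $\mathcal B+(-\alpha)$, and $\infty-\alpha=\infty$, where $\infty$ is an adjoined element greater than all cuts. Filter quasi-valuation. Let $\Gamma_v$ be the value group of $v$. For $0\ne x\in R$ let $S_x=\{a\in O_v\mid x\in aR\}$ and $w(x)=v(S_x)^+\in\mathcal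 M(\Gamma_v)$, where $v(S_x)=\{v(a)\mid a\in S_x\}$; $w(0)=\infty$. Every element of $E$ is of the form $rs^{-1}$ with $r\in R$, $0\ne s\in O_v$, and the filter quasi-valuation on $E$ induced by $(R,v)$ is the well-defined function $w:E\to\mathcal M(\Gamma_v)\cup\{\infty\}$, $w(rs^{-1})=w(r)-v(s)$. It satisfies $w(xy)\ge w(x)+w(y)$, $w(x+y)\ge\min\{w(x),w(y)\}$, $w|_F=v$, and $O_w=\{x\in E\mid w(x)\ge0\}=R$. Comparison of values. $O_u$ is the valuation ring of $u$. The value group of $u$ is torsion over $\Gamma_v$ and is regarded as a subgroup of the divisible hull $\Gamma_{\text{div}}$ of $\Gamma_v$. Both $\mathcal M(\Gamma_v)$ and $\Gamma_{\text{div}}$ embed in the divisible hull $\mathcal M_{\text{div}}=(\mathcal M(\Gamma_v)\times\mathbb N)/\sim$, where $(m_1,n_1)\sim(m_2,n_2)$ iff $n_2m_1=n_1m_2$, ordered by $(m_1,n_1)\le(m_2,n_2)$ iff $n_2m_1\le n_1m_2$; the inequality $w(x)\le u(x)$ is understood in $\mathcal M_{\text{div}}\cup\{\infty\}$. *)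

theory Defs
  imports "HOL-Algebra.Algebra" "HOL-Library.Lattice_Constructions"
begin

section \<open>Adjoining a greatest element\<close>

text \<open>
  The ordered type \<^typ>\<open>'a top\<close> of the library is \<^typ>\<open>'a\<close> with a new greatest element
  \<^const>\<open>top.Top\<close>, which plays the role of \<open>\<infinity>\<close>; it is absorbing for the addition.
\<close>

instantiation top :: (comm_monoid_add) comm_monoid_add
begin

definition zero_top :: "'a top" where
  "zero_top = top.Value 0"

fun plus_top :: "'a top \<Rightarrow> 'a top \<Rightarrow> 'a top" where
  "plus_top (top.Value a) (top.Value b) = top.Value (a + b)"
| "plus_top (top.Value a) top.Top = top.Top"
| "plus_top top.Top y = top.Top"

instance
proof
  fix x y z :: "'a top"
  show "x + y + z = x + (y + z)"
    by (cases x; cases y; cases z) (simp_all add: add.assoc)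
  show "x + y = y + x"
    by (cases x; cases y) (simp_all add: add.commute)
  show "0 + x = x"
    by (cases x) (simp_all add: zero_top_def)
qed

end


section \<open>Divisible hulls\<close>

definition (in comm_monoid_add) nmult :: "nat \<Rightarrow> 'a \<Rightarrow> 'a" where
  "nmult n a = (\<Sum>i<n. a)"

lemma nmult_0 [simp]: "nmult 0 a = 0"
  and nmult_Suc: "nmult (Suc n) a = nmult n a + a"
  and nmult_1 [simp]: "nmult (Suc 0) a = a"
  by (simp_all add: nmult_def)

lemma nmult_zero [simp]: "nmult n 0 = 0"
  by (simp add: nmult_def)

lemma nmult_add: "nmult n (a + b) = nmult n a + nmult n b"
  by (simp add: nmult_def sum.distrib)

lemma nmult_add_left: "nmult (m + n) a = nmult m a + nmult n a"
  by (induction n) (simp_all add: nmult_Suc add.assoc)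

lemma nmult_nmult: "nmult m (nmult n a) = nmult (m * n) a"
  by (induction m) (simp_all add: nmult_Suc nmult_add_left add.commute)

lemma nmult_minus: "nmult n (- a) = - nmult n (a::'a::ab_group_add)"
  by (simp add: nmult_def sum_negf)

text \<open>
  The property \<open>a < b \<Longrightarrow> n a < n b\<close> is what makes the divisible hull below an ordered
  extension; it holds in ordered abelian groups and in their cut monoids.
\<close>

class nmult_strict_linorder = linorder + ordered_comm_monoid_add +
  assumes nmult_strict_mono: "a < b \<Longrightarrow> 0 < n \<Longrightarrow> nmult n a < nmult n b"

lemma nmult_le_iff:
  "0 < n \<Longrightarrow> nmult n a \<le> nmult n b \<longleftrightarrow> a \<le> (b::'a::nmult_strict_linorder)"
  by (metis nmult_strict_mono linorder_not_le order_less_imp_le order_le_less)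

lemma nmult_eq_iff:
  "0 < n \<Longrightarrow> nmult n a = nmult n b \<longleftrightarrow> a = (b::'a::nmult_strict_linorder)"
  by (simp add: order_eq_iff nmult_le_iff)

instance linordered_ab_group_add \<subseteq> nmult_strict_linorder
proof
  fix a b :: 'a and n :: nat
  assume "a < b" "0 < n"
  then show "nmult n a < nmult n b"
    unfolding nmult_def by (intro sum_strict_mono) auto
qed

definition div_rel :: "'a::nmult_strict_linorder \<times> nat \<Rightarrow> 'a \<times> nat \<Rightarrow> bool" where
  "div_rel p q \<longleftrightarrow> 0 < snd p \<and> 0 < snd q \<and> nmult (snd q) (fst p) = nmult (snd p) (fst q)"

text \<open>
  The pair \<open>(a, n)\<close> represents \<open>a / n\<close>; the relation is partial because \<open>n\<close> has to be positive.
  The same construction yields the divisible hull of an ordered abelian group and the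
  divisible hull of its cut monoid.
\<close>

quotient_type (overloaded) 'a div_hull = "'a::nmult_strict_linorder \<times> nat" / partial: div_rel
proof (rule part_equivpI)
  show "\<exists>x::'a \<times> nat. div_rel x x"
    by (rule exI [of _ "(0, 1)"]) (simp add: div_rel_def)
  show "symp (div_rel :: 'a \<times> nat \<Rightarrow> _)"
    by (auto simp: symp_def div_rel_def)
  show "transp (div_rel :: 'a \<times> nat \<Rightarrow> _)"
  proof (rule transpI)
    fix x y z :: "'a \<times> nat"
    assume xy: "div_rel x y" and yz: "div_rel y z"
    have "nmult (snd y) (nmult (snd z) (fst x)) = nmult (snd z) (nmult (snd y) (fst x))"
      by (simp add: nmult_nmult mult.commute)
    also have "\<dots> = nmult (snd x) (nmult (snd z) (fst y))"
      using xy by (simp add: div_rel_def nmult_nmult mult.commute)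
    also have "\<dots> = nmult (snd y) (nmult (snd x) (fst z))"
      using yz by (simp add: div_rel_def nmult_nmult mult.commute)
    finally show "div_rel x z"
      using xy yz by (simp add: div_rel_def nmult_eq_iff)
  qed
qed

lemma div_rel_le_cong:
  fixes a b c d :: "'a::nmult_strict_linorder"
  assumes ab: "div_rel (a, k) (b, l)" and cd: "div_rel (c, m) (d, n)"
  shows "nmult m a \<le> nmult k c \<longleftrightarrow> nmult n b \<le> nmult l d"
proof -
  have pos: "0 < k" "0 < l" "0 < m" "0 < n"
    and e: "nmult l a = nmult k b" "nmult n c = nmult m d"
    using ab cd by (simp_all add: div_rel_def)
  have "nmult m a \<le> nmult k c \<longleftrightarrow> nmult (l * n) (nmult m a) \<le> nmult (l * n) (nmult k c)"
    using pos by (simp add: nmult_le_iff)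
  also have "nmult (l * n) (nmult m a) = nmult (n * m) (nmult l a)"
    by (simp add: nmult_nmult ac_simps)
  also have "\<dots> = nmult (k * m) (nmult n b)"
    by (simp add: e nmult_nmult ac_simps)
  also have "nmult (l * n) (nmult k c) = nmult (l * k) (nmult n c)"
    by (simp add: nmult_nmult ac_simps)
  also have "\<dots> = nmult (k * m) (nmult l d)"
    by (simp add: e nmult_nmult ac_simps)
  finally show ?thesis
    using pos by (simp add: nmult_le_iff)
qed

instantiation div_hull :: (nmult_strict_linorder) linorder
begin

lift_definition less_eq_div_hull :: "'a div_hull \<Rightarrow> 'a div_hull \<Rightarrow> bool"
  is "\<lambda>(a, m) (b, n). nmult n a \<le> nmult m b"
  using div_rel_le_cong by fastforce

definition less_div_hull :: "'a div_hull \<Rightarrow> 'a div_hull \<Rightarrow> bool" where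
  "less_div_hull x y \<longleftrightarrow> x \<le> y \<and> \<not> y \<le> x"

instance
proof
  fix x y z :: "'a div_hull"
  show "x < y \<longleftrightarrow> x \<le> y \<and> \<not> y \<le> x"
    by (rule less_div_hull_def)
  show "x \<le> x"
    by transfer auto
  show "x \<le> y \<or> y \<le> x"
    by transfer auto
  show "x = y" if "x \<le> y" "y \<le> x"
    using that by transfer (auto simp: div_rel_def)
  show "x \<le> z" if "x \<le> y" "y \<le> z"
    using that
  proof (transfer, clarsimp simp: div_rel_def)
    fix a b c :: 'a and k l m :: nat
    assume pos: "0 < k" "0 < l" "0 < m"
      and le: "nmult l a \<le> nmult k b" "nmult m b \<le> nmult l c"
    have "nmult l (nmult m a) = nmult m (nmult l a)"
      by (simp add: nmult_nmult mult.commute)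
    also have "\<dots> \<le> nmult m (nmult k b)"
      using le pos by (simp add: nmult_le_iff)
    also have "\<dots> = nmult k (nmult m b)"
      by (simp add: nmult_nmult mult.commute)
    also have "\<dots> \<le> nmult k (nmult l c)"
      using le pos by (simp add: nmult_le_iff)
    also have "\<dots> = nmult l (nmult k c)"
      by (simp add: nmult_nmult mult.commute)
    finally show "nmult m a \<le> nmult k c"
      using pos by (simp add: nmult_le_iff)
  qed
qed

end

instantiation div_hull :: (nmult_strict_linorder) comm_monoid_add
begin

lift_definition zero_div_hull :: "'a div_hull" is "(0, 1)"
  by (simp add: div_rel_def)

lift_definition plus_div_hull :: "'a div_hull \<Rightarrow> 'a div_hull \<Rightarrow> 'a div_hull"
  is "\<lambda>(a, m) (b, n). (nmult n a + nmult m b, m * n)"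
proof (clarsimp simp: div_rel_def nmult_add)
  fix a c a' c' :: 'a and m n m' n' :: nat
  assume e: "nmult m' a = nmult m a'" "nmult n' c = nmult n c'"
  have "nmult (m' * n') (nmult n a) = nmult (n * n') (nmult m' a)"
    by (simp add: nmult_nmult ac_simps)
  also have "\<dots> = nmult (m * n) (nmult n' a')"
    by (simp add: e nmult_nmult ac_simps)
  finally have 1: "nmult (m' * n') (nmult n a) = nmult (m * n) (nmult n' a')" .
  have "nmult (m' * n') (nmult m c) = nmult (m * m') (nmult n' c)"
    by (simp add: nmult_nmult ac_simps)
  also have "\<dots> = nmult (m * n) (nmult m' c')"
    by (simp add: e nmult_nmult ac_simps)
  finally show "nmult (m' * n') (nmult n a) + nmult (m' * n') (nmult m c) =
      nmult (m * n) (nmult n' a') + nmult (m * n) (nmult m' c')"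
    using 1 by simp
qed

instance
proof
  fix x y z :: "'a div_hull"
  show "x + y + z = x + (y + z)"
    by transfer (auto simp: div_rel_def nmult_add nmult_nmult ac_simps)
  show "x + y = y + x"
    by transfer (auto simp: div_rel_def ac_simps)
  show "0 + x = x"
    by transfer (auto simp: div_rel_def)
qed

end

instantiation div_hull :: (linordered_ab_group_add) linordered_ab_group_add
begin

lift_definition uminus_div_hull :: "'a div_hull \<Rightarrow> 'a div_hull" is "\<lambda>(a, m). (- a, m)"
  by (auto simp: div_rel_def nmult_minus)

definition minus_div_hull :: "'a div_hull \<Rightarrow> 'a div_hull \<Rightarrow> 'a div_hull" where
  "minus_div_hull x y = x + - y"

instance
proof
  fix x y z :: "'a div_hull"
  show "- x + x = 0"
    by transfer (auto simp: div_rel_def nmult_minus)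
  show "x - y = x + - y"
    by (rule minus_div_hull_def)
  show "z + x \<le> z + y" if "x \<le> y"
    using that
  proof (transfer, clarsimp simp: div_rel_def nmult_add)
    fix a b c :: 'a and k l m :: nat
    assume pos: "0 < k" "0 < l" "0 < m" and le: "nmult l a \<le> nmult k b"
    have "nmult (m * l) (nmult m a) = nmult (m * m) (nmult l a)"
      by (simp add: nmult_nmult ac_simps)
    also have "\<dots> \<le> nmult (m * m) (nmult k b)"
      using le pos by (simp add: nmult_le_iff)
    finally have 1: "nmult (m * l) (nmult m a) \<le> nmult (m * k) (nmult m b)"
      by (simp add: nmult_nmult ac_simps)
    have 2: "nmult (m * l) (nmult k c) = nmult (m * k) (nmult l c)"
      by (simp add: nmult_nmult ac_simps)
    show "nmult (m * l) (nmult k c) + nmult (m * l) (nmult m a)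
        \<le> nmult (m * k) (nmult l c) + nmult (m * k) (nmult m b)"
      using 1 by (simp add: 2)
  qed
qed

end

lift_definition to_div_hull :: "'a::nmult_strict_linorder \<Rightarrow> 'a div_hull" is "\<lambda>a. (a, 1)"
  by (simp add: div_rel_def)

lemma to_div_hull_le_iff [simp]: "to_div_hull a \<le> to_div_hull b \<longleftrightarrow> a \<le> b"
  by transfer simp

lemma to_div_hull_add: "to_div_hull (a + b) = to_div_hull a + to_div_hull b"
  by transfer (simp add: div_rel_def)


section \<open>The cut monoid of an ordered abelian group\<close>

typedef (overloaded) 'a cut =
  "{(L, R :: 'a::linordered_ab_group_add set).
      L \<union> R = UNIV \<and> L \<inter> R = {} \<and> (\<forall>\<alpha>\<in>L. \<forall>\<beta>\<in>R. \<alpha> < \<beta>)}"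
  by (rule exI [of _ "({}, UNIV)"]) simp

definition cut_lower :: "'a::linordered_ab_group_add cut \<Rightarrow> 'a set" where
  "cut_lower A = fst (Rep_cut A)"

definition cut_upper :: "'a::linordered_ab_group_add cut \<Rightarrow> 'a set" where
  "cut_upper A = snd (Rep_cut A)"

definition cut_of_lower :: "'a::linordered_ab_group_add set \<Rightarrow> 'a cut" where
  "cut_of_lower L = Abs_cut (L, - L)"

lemma cut_upper_eq: "cut_upper A = - cut_lower A"
  using Rep_cut [of A] unfolding cut_lower_def cut_upper_def by auto

lemma lower_down_closed: "\<beta> \<in> cut_lower A \<Longrightarrow> \<alpha> \<le> \<beta> \<Longrightarrow> \<alpha> \<in> cut_lower A"
  using Rep_cut [of A] unfolding cut_lower_def by (fastforce simp: not_less)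

lemma cut_eqI: "cut_lower A = cut_lower B \<Longrightarrow> A = B"
  using cut_upper_eq [of A] cut_upper_eq [of B]
  by (metis Rep_cut_inject cut_lower_def cut_upper_def prod.collapse)

lemma lower_cut_of_lower:
  assumes "\<And>\<alpha> \<beta>. \<beta> \<in> L \<Longrightarrow> \<alpha> \<le> \<beta> \<Longrightarrow> \<alpha> \<in> L"
  shows "cut_lower (cut_of_lower L) = L"
  unfolding cut_lower_def cut_of_lower_def
  using assms by (subst Abs_cut_inverse) (auto simp: not_less [symmetric])

instantiation cut :: (linordered_ab_group_add) linorder
begin

definition less_eq_cut :: "'a cut \<Rightarrow> 'a cut \<Rightarrow> bool" where
  "A \<le> B \<longleftrightarrow> cut_lower A \<subseteq> cut_lower B"

definition less_cut :: "'a cut \<Rightarrow> 'a cut \<Rightarrow> bool" where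
  "less_cut A B \<longleftrightarrow> A \<le> B \<and> \<not> B \<le> A"

instance
proof
  fix A B C :: "'a cut"
  show "A < B \<longleftrightarrow> A \<le> B \<and> \<not> B \<le> A"
    by (rule less_cut_def)
  show "A \<le> A"
    by (simp add: less_eq_cut_def)
  show "A \<le> C" if "A \<le> B" "B \<le> C"
    using that by (simp add: less_eq_cut_def)
  show "A = B" if "A \<le> B" "B \<le> A"
    using that by (intro cut_eqI) (simp add: less_eq_cut_def)
  show "A \<le> B \<or> B \<le> A"
    unfolding less_eq_cut_def by (meson lower_down_closed linear subsetI)
qed

end

definition cut_above :: "'a::linordered_ab_group_add set \<Rightarrow> 'a cut" where
  "cut_above S = (LEAST A. S \<subseteq> cut_lower A)"

lemma cut_above_eq: "cut_above S = cut_of_lower {\<alpha>. \<exists>\<beta>\<in>S. \<alpha> \<le> \<beta>}"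
  and lower_cut_above: "cut_lower (cut_above S) = {\<alpha>. \<exists>\<beta>\<in>S. \<alpha> \<le> \<beta>}"
proof -
  have l: "cut_lower (cut_of_lower {\<alpha>. \<exists>\<beta>\<in>S. \<alpha> \<le> \<beta>}) = {\<alpha>. \<exists>\<beta>\<in>S. \<alpha> \<le> \<beta>}"
    by (rule lower_cut_of_lower) (auto intro: order_trans)
  show e: "cut_above S = cut_of_lower {\<alpha>. \<exists>\<beta>\<in>S. \<alpha> \<le> \<beta>}"
    unfolding cut_above_def
    by (rule Least_equality) (auto simp: less_eq_cut_def l intro: lower_down_closed)
  show "cut_lower (cut_above S) = {\<alpha>. \<exists>\<beta>\<in>S. \<alpha> \<le> \<beta>}"
    unfolding e by (rule l)
qed

definition point_cut :: "'a::linordered_ab_group_add \<Rightarrow> 'a cut" where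
  "point_cut \<alpha> = cut_above {\<alpha>}"

lemma lower_point_cut: "cut_lower (point_cut \<alpha>) = {..\<alpha>}"
  by (auto simp: point_cut_def lower_cut_above)

instantiation cut :: (linordered_ab_group_add) comm_monoid_add
begin

definition zero_cut :: "'a cut" where
  "0 = point_cut 0"

definition plus_cut :: "'a cut \<Rightarrow> 'a cut \<Rightarrow> 'a cut" where
  "A + B = cut_of_lower {\<alpha> + \<beta> | \<alpha> \<beta>. \<alpha> \<in> cut_lower A \<and> \<beta> \<in> cut_lower B}"

lemma lower_plus: "cut_lower (A + B) = {\<alpha> + \<beta> | \<alpha> \<beta>. \<alpha> \<in> cut_lower A \<and> \<beta> \<in> cut_lower B}"
  unfolding plus_cut_def
proof (rule lower_cut_of_lower, clarify)
  fix \<gamma> \<alpha> \<beta> assume "\<gamma> \<le> \<alpha> + \<beta>" "\<alpha> \<in> cut_lower A" "\<beta> \<in> cut_lower B"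
  then have "\<gamma> - \<beta> \<in> cut_lower A"
    by (auto intro: lower_down_closed simp: diff_le_eq)
  with \<open>\<beta> \<in> cut_lower B\<close> show "\<exists>\<alpha> \<beta>. \<gamma> = \<alpha> + \<beta> \<and> \<alpha> \<in> cut_lower A \<and> \<beta> \<in> cut_lower B"
    by (intro exI [of _ "\<gamma> - \<beta>"] exI [of _ \<beta>]) simp
qed

instance
proof (intro_classes, goal_cases)
  case (1 A B C)
  show ?case
    by (rule cut_eqI) (auto simp: lower_plus, (metis add.assoc)+)
next
  case (2 A B)
  show ?case
    by (rule cut_eqI) (auto simp: lower_plus, (metis add.commute)+)
next
  case (3 A)
  show ?case
  proof (rule cut_eqI)
    show "cut_lower (0 + A) = cut_lower A"
    proof (rule Set.set_eqI, rule iffI)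
      fix \<gamma> assume "\<gamma> \<in> cut_lower (0 + A)"
      then obtain \<alpha> \<beta> where "\<gamma> = \<alpha> + \<beta>" "\<alpha> \<le> 0" "\<beta> \<in> cut_lower A"
        by (auto simp: lower_plus zero_cut_def lower_point_cut)
      then show "\<gamma> \<in> cut_lower A"
        by (auto intro: lower_down_closed [of \<beta>])
    next
      fix \<gamma> assume "\<gamma> \<in> cut_lower A"
      then show "\<gamma> \<in> cut_lower (0 + A)"
        by (force simp: lower_plus zero_cut_def lower_point_cut)
    qed
  qed
qed

end

instance cut :: (linordered_ab_group_add) nmult_strict_linorder
proof (intro_classes, goal_cases)
  case (1 A B C)
  then show ?case
    by (auto simp: less_eq_cut_def lower_plus)
next
  case (2 A B n)
  then obtain \<beta> where \<beta>: "\<beta> \<in> cut_lower B" "\<beta> \<notin> cut_lower A"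
    by (auto simp: less_cut_def less_eq_cut_def)
  have bound: "\<alpha> < \<beta>" if "\<alpha> \<in> cut_lower A" for \<alpha>
    using that \<beta> by (meson lower_down_closed not_less)
  have B: "nmult m \<beta> \<in> cut_lower (nmult m B)" for m
  proof (induction m)
    case 0
    show ?case by (simp add: zero_cut_def lower_point_cut)
  next
    case (Suc m)
    then show ?case using \<beta> by (auto simp: nmult_Suc lower_plus)
  qed
  have A': "\<gamma> < nmult (Suc m) \<beta>" if "\<gamma> \<in> cut_lower (nmult (Suc m) A)" for m \<gamma>
    using that
  proof (induction m arbitrary: \<gamma>)
    case 0
    then show ?case using bound by simp
  next
    case (Suc m)
    from Suc.prems obtain \<delta> \<alpha>
      where "\<gamma> = \<delta> + \<alpha>" "\<delta> \<in> cut_lower (nmult (Suc m) A)" "\<alpha> \<in> cut_lower A"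
      unfolding nmult_Suc [of "Suc m"] lower_plus by blast
    then show ?case
      using Suc.IH [of \<delta>] bound [of \<alpha>] by (simp add: nmult_Suc [of "Suc m"] add_strict_mono)
  qed
  from \<open>0 < n\<close> obtain m where m: "n = Suc m"
    by (cases n) auto
  have "nmult n \<beta> \<notin> cut_lower (nmult n A)"
    using A' [of "nmult n \<beta>" m] m by auto
  with B [of n] have "\<not> nmult n B \<le> nmult n A"
    by (auto simp: less_eq_cut_def)
  then show ?case by (simp add: not_le)
qed

lemma point_cut_le_iff [simp]: "point_cut \<alpha> \<le> point_cut \<beta> \<longleftrightarrow> \<alpha> \<le> \<beta>"
  by (auto simp: less_eq_cut_def lower_point_cut)

lemma point_cut_add: "point_cut (\<alpha> + \<beta>) = point_cut \<alpha> + point_cut \<beta>"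
proof (rule cut_eqI, unfold lower_plus lower_point_cut, intro Set.set_eqI iffI)
  fix \<gamma> assume "\<gamma> \<in> {..\<alpha> + \<beta>}"
  then show "\<gamma> \<in> {a + b | a b. a \<in> {..\<alpha>} \<and> b \<in> {..\<beta>}}"
    by (intro CollectI exI [of _ "\<gamma> - \<beta>"] exI [of _ \<beta>]) (simp add: diff_le_eq)
qed (auto intro: add_mono)

lemma point_cut_nmult: "point_cut (nmult n \<alpha>) = nmult n (point_cut \<alpha>)"
  by (induction n) (simp_all add: nmult_Suc point_cut_add zero_cut_def)

text \<open>The embedding of the divisible hull of the group into that of the cut monoid.\<close>

lift_definition div_point_cut ::
  "'a::linordered_ab_group_add div_hull \<Rightarrow> 'a cut div_hull" is "\<lambda>(\<alpha>, n). (point_cut \<alpha>, n)"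
  by (auto simp: div_rel_def simp flip: point_cut_nmult)

lemma div_point_cut_le_iff [simp]: "div_point_cut x \<le> div_point_cut y \<longleftrightarrow> x \<le> y"
  by transfer (auto simp flip: point_cut_nmult)

lemma div_point_cut_to_div_hull: "div_point_cut (to_div_hull \<alpha>) = to_div_hull (point_cut \<alpha>)"
  by transfer (simp add: div_rel_def)


section \<open>Valuations and the filter quasi-valuation\<close>

text \<open>
  Subfields of \<open>E\<close> are sets, so a valuation is a function on \<^typ>\<open>'a\<close> of which only the values
  on the given subfield \<open>K\<close> are relevant. Its value group may be a proper subgroup of
  \<^typ>\<open>'g\<close>.
\<close>

definition valuation ::
  "('a, 'b) ring_scheme \<Rightarrow> 'a set \<Rightarrow> ('a \<Rightarrow> 'g::linordered_ab_group_add top) \<Rightarrow> bool" where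
  "valuation E K v \<longleftrightarrow>
     (\<forall>x\<in>K. v x = top.Top \<longleftrightarrow> x = \<zero>\<^bsub>E\<^esub>) \<and>
     (\<forall>x\<in>K. \<forall>y\<in>K. v (x \<otimes>\<^bsub>E\<^esub> y) = v x + v y) \<and>
     (\<forall>x\<in>K. \<forall>y\<in>K. min (v x) (v y) \<le> v (x \<oplus>\<^bsub>E\<^esub> y))"

definition value_group ::
  "('a, 'b) ring_scheme \<Rightarrow> 'a set \<Rightarrow> ('a \<Rightarrow> 'g::linordered_ab_group_add top) \<Rightarrow> 'g set" where
  "value_group E K v = {\<gamma>. \<exists>x\<in>K - {\<zero>\<^bsub>E\<^esub>}. v x = top.Value \<gamma>}"

text \<open>Used both for \<open>O\<^sub>v\<close> of a valuation and for \<open>O\<^sub>w\<close> of a quasi-valuation.\<close>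

definition nonneg_part :: "'a set \<Rightarrow> ('a \<Rightarrow> 'm::{comm_monoid_add, linorder} top) \<Rightarrow> 'a set" where
  "nonneg_part K v = {x \<in> K. 0 \<le> v x}"

definition extends_valuation ::
  "'a set \<Rightarrow> ('a \<Rightarrow> 'g::linordered_ab_group_add top) \<Rightarrow> ('a \<Rightarrow> 'g div_hull top) \<Rightarrow> bool" where
  "extends_valuation F v u \<longleftrightarrow> (\<forall>x\<in>F. u x = map_top to_div_hull (v x))"

definition is_fraction_field_of :: "('a, 'b) ring_scheme \<Rightarrow> 'a set \<Rightarrow> bool" where
  "is_fraction_field_of E R \<longleftrightarrow>
     (\<forall>x\<in>carrier E. \<exists>a\<in>R. \<exists>b\<in>R - {\<zero>\<^bsub>E\<^esub>}. x = a \<otimes>\<^bsub>E\<^esub> inv\<^bsub>E\<^esub> b)"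

definition divisor_set ::
  "('a, 'b) ring_scheme \<Rightarrow> 'a set \<Rightarrow> 'a set \<Rightarrow> ('a \<Rightarrow> 'g::linordered_ab_group_add top) \<Rightarrow> 'a \<Rightarrow> 'a set"
  where "divisor_set E F R v x = {a \<in> nonneg_part F v. x \<in> a <#\<^bsub>E\<^esub> R}"

text \<open>
  For \<open>x \<noteq> 0\<close> the set \<open>S\<^sub>x\<close> does not contain \<open>0\<close>, so no value in \<open>v(S\<^sub>x)\<close> is \<open>\<infinity>\<close>.
\<close>

definition filter_qv_ring ::
  "('a, 'b) ring_scheme \<Rightarrow> 'a set \<Rightarrow> 'a set \<Rightarrow> ('a \<Rightarrow> 'g::linordered_ab_group_add top) \<Rightarrow>
     'a \<Rightarrow> 'g cut top" where
  "filter_qv_ring E F R v x =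
     (if x = \<zero>\<^bsub>E\<^esub> then top.Top
      else top.Value (cut_above {\<gamma>. top.Value \<gamma> \<in> v ` divisor_set E F R v x}))"

text \<open>
  \<open>w(r s\<^sup>-\<^sup>1) = w(r) - v(s)\<close>, the difference being \<open>w(r) + (-v(s))\<close> with \<open>-v(s)\<close> regarded
  as a cut; it does not depend on the choice of \<open>r\<close> and \<open>s\<close>.
\<close>

definition filter_quasi_valuation ::
  "('a, 'b) ring_scheme \<Rightarrow> 'a set \<Rightarrow> 'a set \<Rightarrow> ('a \<Rightarrow> 'g::linordered_ab_group_add top) \<Rightarrow>
     'a \<Rightarrow> 'g cut top" where
  "filter_quasi_valuation E F R v x =
     (THE m. \<exists>r\<in>R. \<exists>s\<in>nonneg_part F v - {\<zero>\<^bsub>E\<^esub>}. \<exists>\<gamma>.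
        x = r \<otimes>\<^bsub>E\<^esub> inv\<^bsub>E\<^esub> s \<and> v s = top.Value \<gamma> \<and>
        m = filter_qv_ring E F R v r + top.Value (point_cut (- \<gamma>)))"

end

theory Submission
  imports Defs
begin

text \<open>
  The valuation \<open>u\<close> comes from a maximal subring \<open>S \<supseteq> R\<close> with \<open>S \<inter> F = O\<^sub>v\<close>. The ideal
  \<open>J = M\<^sub>v S\<close> is proper, because finitely generated ideals of \<open>O\<^sub>v\<close> are principal, so an equation
  \<open>1 = m s\<close> would put \<open>m\<^sup>-\<^sup>1\<close> into \<open>S \<inter> F\<close>. By maximality \<open>1 - J\<close> consists of units, and
  \<open>1 \<in> J S[x]\<close> for every \<open>x \<notin> S\<close>; relations of minimal degree for \<open>x\<close> and \<open>x\<^sup>-\<^sup>1\<close> contradict each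
  other, so \<open>S\<close> is a valuation ring. As \<open>E\<close> is algebraic over \<open>F\<close>, two terms of a polynomial
  equation for \<open>x\<close> have the same \<open>S\<close>-value, hence \<open>x\<^sup>n = a e\<close> with \<open>a \<in> F\<close> and a unit \<open>e\<close> of \<open>S\<close>,
  and \<open>u(x) = v(a) / n\<close>.

  The domination is direct: if \<open>r \<in> a R\<close> and \<open>O\<^sub>u \<supseteq> R\<close> then \<open>v(a) \<le> u(r)\<close>. A cut lies below a point of
  the divisible hull as soon as all elements of its lower part do.
\<close>

section \<open>Divisible hulls\<close>

lemma nmult_nonneg_iff: "0 < n \<Longrightarrow> 0 \<le> nmult n a \<longleftrightarrow> 0 \<le> (a::'a::nmult_strict_linorder)"
  using nmult_le_iff [of n 0 a] by simp

lemma to_div_hull_0 [simp]: "to_div_hull 0 = 0"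
  by transfer (simp add: div_rel_def)

lemma to_div_hull_nmult: "to_div_hull (nmult n a) = nmult n (to_div_hull a)"
  by (induction n) (simp_all add: nmult_Suc to_div_hull_add)

lemma to_div_hull_minus:
  "to_div_hull (- a) = - to_div_hull (a::'a::linordered_ab_group_add)"
  by transfer (simp add: div_rel_def)

text \<open>Denotes a/(k+1). The shifted denominator is positive by construction, so the lifting is
  total.\<close>

lift_definition frac_Suc :: "'a::nmult_strict_linorder \<Rightarrow> nat \<Rightarrow> 'a div_hull"
  is "\<lambda>a k. (a, Suc k)"
  by (simp add: div_rel_def)

lemma frac_Suc_0 [simp]: "frac_Suc 0 k = 0"
  by transfer (simp add: div_rel_def)

lemma frac_Suc_add: "frac_Suc (a + b) k = frac_Suc a k + frac_Suc b k"
  by transfer (auto simp: div_rel_def nmult_add nmult_nmult simp del: mult_Suc mult_Suc_right)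

lemma nmult_frac_Suc: "nmult n (frac_Suc a k) = frac_Suc (nmult n a) k"
  by (induction n) (simp_all add: nmult_Suc frac_Suc_add)

lemma to_div_hull_divisible:
  assumes "0 < n"
  obtains q where "nmult n q = to_div_hull a"
proof -
  obtain k where k: "n = Suc k"
    using assms by (cases n) auto
  have "frac_Suc (nmult (Suc k) a) k = to_div_hull a"
    by transfer (simp add: div_rel_def nmult_nmult)
  then have "nmult n (frac_Suc a k) = to_div_hull a"
    by (simp add: nmult_frac_Suc k)
  then show thesis
    by (rule that)
qed

text \<open>An element of the lower part of an n-fold sum is a sum of n elements of
  \<open>cut_lower A\<close>, and their maximum again lies in \<open>cut_lower A\<close>.\<close>

lemma lower_nmult_bound:
  assumes "0 < n" "\<gamma> \<in> cut_lower (nmult n A)"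
  shows "\<exists>\<alpha>\<in>cut_lower A. \<gamma> \<le> nmult n \<alpha>"
  using assms
proof (induction n arbitrary: \<gamma> rule: nat_induct_non_zero)
  case 1
  then show ?case by auto
next
  case (Suc n)
  from Suc.prems obtain \<delta> \<beta>
    where \<delta>: "\<gamma> = \<delta> + \<beta>" "\<delta> \<in> cut_lower (nmult n A)" "\<beta> \<in> cut_lower A"
    unfolding nmult_Suc lower_plus by blast
  obtain \<alpha> where \<alpha>: "\<alpha> \<in> cut_lower A" "\<delta> \<le> nmult n \<alpha>"
    using Suc.IH [OF \<delta>(2)] by blast
  have "nmult n \<alpha> \<le> nmult n (max \<alpha> \<beta>)"
    using Suc.hyps by (simp add: nmult_le_iff)
  then have "\<delta> \<le> nmult n (max \<alpha> \<beta>)"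
    using \<alpha>(2) by (rule order_trans [rotated])
  then have "\<gamma> \<le> nmult (Suc n) (max \<alpha> \<beta>)"
    unfolding nmult_Suc \<delta>(1) by (rule add_mono) simp
  moreover have "max \<alpha> \<beta> \<in> cut_lower A"
    using \<alpha> \<delta> by (simp add: max_def)
  ultimately show ?case by blast
qed

text \<open>With q = g/n the claim reads nA \<le> \<open>point_cut g\<close>. Every element of the
  lower part of nA is at most some n \<alpha> with \<alpha> in the lower part of A, hence at most
  g.\<close>

lemma to_div_hull_le_div_point_cut:
  fixes A :: "'g::linordered_ab_group_add cut"
  assumes "\<And>\<alpha>. \<alpha> \<in> cut_lower A \<Longrightarrow> to_div_hull \<alpha> \<le> q"
  shows "to_div_hull A \<le> div_point_cut q"
  using assms
proof (transfer, clarsimp simp: div_rel_def)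
  fix A :: "'g cut" and g :: 'g and n :: nat
  assume n: "0 < n" and le: "\<And>\<alpha>. \<alpha> \<in> cut_lower A \<Longrightarrow> nmult n \<alpha> \<le> g"
  show "nmult n A \<le> point_cut g"
    unfolding less_eq_cut_def lower_point_cut
  proof
    fix \<gamma> assume "\<gamma> \<in> cut_lower (nmult n A)"
    then obtain \<alpha> where "\<alpha> \<in> cut_lower A" "\<gamma> \<le> nmult n \<alpha>"
      using lower_nmult_bound [OF n] by blast
    then show "\<gamma> \<in> {..g}"
      using le [of \<alpha>] by simp
  qed
qed


section \<open>Fields and subfields\<close>

context field
begin

lemma inv_simps [simp]:
  assumes "x \<in> carrier R" "x \<noteq> \<zero>"
  shows "inv x \<in> carrier R" "inv x \<noteq> \<zero>" "x \<otimes> inv x = \<one>" "inv x \<otimes> x = \<one>" "inv (inv x) = x"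
proof -
  have "x \<in> Units R"
    using assms by (simp add: field_Units)
  then show "inv x \<in> carrier R" "x \<otimes> inv x = \<one>" "inv x \<otimes> x = \<one>" "inv (inv x) = x"
    by simp_all
  then show "inv x \<noteq> \<zero>"
    using assms by auto
qed

lemma m_eq_zero_iff [simp]:
  "x \<in> carrier R \<Longrightarrow> y \<in> carrier R \<Longrightarrow> x \<otimes> y = \<zero> \<longleftrightarrow> x = \<zero> \<or> y = \<zero>"
  using integral by auto

lemma nat_pow_nonzero: "x \<in> carrier R \<Longrightarrow> x \<noteq> \<zero> \<Longrightarrow> x [^] (n::nat) \<noteq> \<zero>"
  by (induction n) auto

lemma cancel_inv [simp]:
  assumes "x \<in> carrier R" "x \<noteq> \<zero>" "y \<in> carrier R"
  shows "x \<otimes> (inv x \<otimes> y) = y" "inv x \<otimes> (x \<otimes> y) = y"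
  using assms by (simp_all flip: m_assoc)

lemma inv_mult_nonzero:
  assumes "x \<in> carrier R" "x \<noteq> \<zero>" "y \<in> carrier R" "y \<noteq> \<zero>"
  shows "inv (x \<otimes> y) = inv x \<otimes> inv y"
  using assms by (intro comm_inv_char) (simp_all add: m_ac)

end


section \<open>Valued fields\<close>

locale valued_field = field E for E (structure) +
  fixes K :: "'a set" and v :: "'a \<Rightarrow> 'g::linordered_ab_group_add top"
  assumes K: "subfield K E" and valuation: "valuation E K v"
begin

text \<open>Strips the constructor \<open>top.Value\<close> so that group arithmetic applies. The
  default 0 at infinity is a dummy: on \<open>K\<close> it is taken only at zero, which is treated
  separately.\<close>

definition val :: "'a \<Rightarrow> 'g" where
  "val x = (case v x of top.Value \<gamma> \<Rightarrow> \<gamma> | top.Top \<Rightarrow> 0)"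

abbreviation O\<^sub>v :: "'a set" where
  "O\<^sub>v \<equiv> nonneg_part K v"

lemma K_carrier [simp]: "x \<in> K \<Longrightarrow> x \<in> carrier E"
  using subfieldE(3) [OF K] by blast

lemmas K_closed [simp] = subringE(2,3,5-7) [OF subfieldE(1) [OF K]]

lemma K_inv [simp]: "x \<in> K \<Longrightarrow> x \<noteq> \<zero> \<Longrightarrow> inv x \<in> K"
  using subfield_m_inv(1) [OF K] by blast

lemma K_pow [simp]: "x \<in> K \<Longrightarrow> x [^] (n::nat) \<in> K"
  by (induction n) auto

lemma v_eq_val: "x \<in> K \<Longrightarrow> x \<noteq> \<zero> \<Longrightarrow> v x = top.Value (val x)"
  using valuation by (cases "v x") (auto simp: valuation_def val_def)

lemma v_zero [simp]: "v \<zero> = top.Top"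
  using valuation by (auto simp: valuation_def)

lemma val_mult:
  assumes "x \<in> K" "x \<noteq> \<zero>" "y \<in> K" "y \<noteq> \<zero>"
  shows "val (x \<otimes> y) = val x + val y"
proof -
  have "v (x \<otimes> y) = v x + v y"
    using assms valuation by (auto simp: valuation_def)
  then show ?thesis
    using assms by (simp add: v_eq_val)
qed

lemma val_add:
  assumes "x \<in> K" "x \<noteq> \<zero>" "y \<in> K" "y \<noteq> \<zero>" "x \<oplus> y \<noteq> \<zero>"
  shows "min (val x) (val y) \<le> val (x \<oplus> y)"
proof -
  have "min (v x) (v y) \<le> v (x \<oplus> y)"
    using assms valuation by (auto simp: valuation_def)
  then show ?thesis
    using assms by (auto simp: v_eq_val min_def split: if_splits)
qed

lemma val_one [simp]: "val \<one> = 0"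
  using val_mult [of \<one> \<one>] by simp

lemma val_inv: "x \<in> K \<Longrightarrow> x \<noteq> \<zero> \<Longrightarrow> val (inv x) = - val x"
  using val_mult [of x "inv x"] by (simp add: eq_neg_iff_add_eq_0 add.commute)

lemma val_pow: "x \<in> K \<Longrightarrow> x \<noteq> \<zero> \<Longrightarrow> val (x [^] (n::nat)) = nmult n (val x)"
  by (induction n) (simp_all add: val_mult nmult_Suc nat_pow_nonzero)

text \<open>-1 squares to 1, and an ordered group has no 2-torsion, so -1 has value 0.\<close>

lemma val_uminus:
  assumes "x \<in> K" "x \<noteq> \<zero>"
  shows "val (\<ominus> x) = val x"
proof -
  have "\<ominus> \<one> \<noteq> \<zero>"
    by (metis minus_minus minus_zero one_closed one_not_zero)
  then have "val (\<ominus> \<one>) + val (\<ominus> \<one>) = val (\<ominus> \<one> \<otimes> \<ominus> \<one>)"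
    by (subst val_mult) auto
  then have "val (\<ominus> \<one>) = 0"
    by (simp add: l_minus)
  moreover have "val (\<ominus> x) = val (\<ominus> \<one> \<otimes> x)"
    using assms by (simp add: l_minus)
  ultimately show ?thesis
    using assms by (subst (asm) val_mult) auto
qed

lemma mem_O_iff: "x \<in> O\<^sub>v \<longleftrightarrow> x \<in> K \<and> (x = \<zero> \<or> 0 \<le> val x)"
  by (cases "x = \<zero>") (auto simp: nonneg_part_def v_eq_val zero_top_def)

lemma O_subring: "subring O\<^sub>v E"
proof (rule subringI)
  fix x y assume xy: "x \<in> O\<^sub>v" "y \<in> O\<^sub>v"
  then show "\<ominus> x \<in> O\<^sub>v"
    by (cases "x = \<zero>") (auto simp: mem_O_iff val_uminus)
  show "x \<otimes> y \<in> O\<^sub>v"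
    using xy by (cases "x = \<zero> \<or> y = \<zero>") (auto simp: mem_O_iff val_mult)
  show "x \<oplus> y \<in> O\<^sub>v"
  proof (cases "x = \<zero> \<or> y = \<zero> \<or> x \<oplus> y = \<zero>")
    case False
    then have "min (val x) (val y) \<le> val (x \<oplus> y)"
      using xy by (intro val_add) (auto simp: mem_O_iff)
    moreover have "0 \<le> min (val x) (val y)"
      using xy False by (auto simp: mem_O_iff)
    ultimately have "0 \<le> val (x \<oplus> y)"
      by (rule order_trans [rotated])
    then show ?thesis
      using xy by (simp add: mem_O_iff)
  qed (use xy in \<open>auto simp: mem_O_iff\<close>)
qed (auto simp: mem_O_iff)

end


section \<open>Maximal subrings and valuation rings\<close>

locale subring_ideal = field E for E (structure) +
  fixes S J :: "'a set"
  assumes S: "subring S E"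
    and J_subset: "J \<subseteq> S"
    and zero_J [simp]: "\<zero> \<in> J"
    and add_J [simp]: "a \<in> J \<Longrightarrow> b \<in> J \<Longrightarrow> a \<oplus> b \<in> J"
    and mult_J [simp]: "s \<in> S \<Longrightarrow> a \<in> J \<Longrightarrow> s \<otimes> a \<in> J"
begin

lemma S_carrier [simp]: "x \<in> S \<Longrightarrow> x \<in> carrier E"
  using subringE(1) [OF S] by blast

lemma J_S [simp]: "x \<in> J \<Longrightarrow> x \<in> S"
  using J_subset by blast

lemmas S_closed [simp] = subringE(2,3,5-7) [OF S]

text \<open>Values at x of the polynomials of degree less than n with coefficients in
  \<open>J\<close>, in Horner form. The argument n counts coefficients, so the relation 1 = 0 is the
  only one that n = 0 would allow.\<close>

primrec poly_vals :: "'a \<Rightarrow> nat \<Rightarrow> 'a set" where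
  "poly_vals x 0 = {\<zero>}"
| "poly_vals x (Suc n) = {b \<otimes> x \<oplus> a | a b. a \<in> J \<and> b \<in> poly_vals x n}"

lemma poly_vals_SucI [intro]:
  "a \<in> J \<Longrightarrow> b \<in> poly_vals x n \<Longrightarrow> b \<otimes> x \<oplus> a \<in> poly_vals x (Suc n)"
  by auto

lemma poly_vals_SucE:
  assumes "y \<in> poly_vals x (Suc n)"
  obtains a b where "y = b \<otimes> x \<oplus> a" "a \<in> J" "b \<in> poly_vals x n"
  using assms by auto

declare poly_vals.simps(2) [simp del]

context
  fixes x assumes x [simp]: "x \<in> carrier E"
begin

lemma poly_vals_carrier: "y \<in> poly_vals x n \<Longrightarrow> y \<in> carrier E"
  by (induction n arbitrary: y) (auto elim!: poly_vals_SucE)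

lemma zero_poly_vals: "\<zero> \<in> poly_vals x n"
proof (induction n)
  case (Suc n)
  then show ?case
    using poly_vals_SucI [OF zero_J Suc] by simp
qed simp

lemma poly_vals_add: "y \<in> poly_vals x n \<Longrightarrow> z \<in> poly_vals x n \<Longrightarrow> y \<oplus> z \<in> poly_vals x n"
proof (induction n arbitrary: y z)
  case (Suc n)
  obtain a b where y: "y = b \<otimes> x \<oplus> a" "a \<in> J" "b \<in> poly_vals x n"
    using Suc.prems(1) by (rule poly_vals_SucE)
  obtain a' b' where z: "z = b' \<otimes> x \<oplus> a'" "a' \<in> J" "b' \<in> poly_vals x n"
    using Suc.prems(2) by (rule poly_vals_SucE)
  have "y \<oplus> z = (b \<oplus> b') \<otimes> x \<oplus> (a \<oplus> a')"
    using y z by (simp add: l_distr a_ac poly_vals_carrier)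
  then show ?case
    using y z Suc.IH [of b b'] by (simp add: poly_vals_SucI)
qed auto

lemma poly_vals_mult: "s \<in> S \<Longrightarrow> y \<in> poly_vals x n \<Longrightarrow> s \<otimes> y \<in> poly_vals x n"
proof (induction n arbitrary: y)
  case (Suc n)
  obtain a b where y: "y = b \<otimes> x \<oplus> a" "a \<in> J" "b \<in> poly_vals x n"
    using Suc.prems(2) by (rule poly_vals_SucE)
  have "s \<otimes> y = (s \<otimes> b) \<otimes> x \<oplus> s \<otimes> a"
    using y Suc.prems(1) by (simp add: r_distr m_assoc poly_vals_carrier)
  then show ?case
    using y Suc.IH [of b] Suc.prems by (simp add: poly_vals_SucI)
qed auto

lemma poly_vals_shift:
  assumes "y \<in> poly_vals x n"
  shows "x \<otimes> y \<in> poly_vals x (Suc n)"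
  using poly_vals_SucI [OF zero_J assms] assms by (simp add: m_comm poly_vals_carrier)

lemma poly_vals_pow: "a \<in> J \<Longrightarrow> a \<otimes> x [^] n \<in> poly_vals x (Suc n)"
proof (induction n)
  case (Suc n)
  have "a \<otimes> x [^] Suc n = x \<otimes> (a \<otimes> x [^] n)"
    using Suc.prems by (simp add: m_ac)
  then show ?case
    using poly_vals_shift [OF Suc.IH [OF Suc.prems]] by (simp only:)
next
  case 0
  then show ?case
    using poly_vals_SucI [OF 0 zero_poly_vals [of 0]] by simp
qed

lemma poly_vals_Suc: "poly_vals x n \<subseteq> poly_vals x (Suc n)"
proof (induction n)
  case (Suc n)
  then show ?case
    by (auto elim!: poly_vals_SucE)
qed (simp add: zero_poly_vals)

text \<open>The Horner recursion splits off the constant coefficient; lowering the degree of a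
  relation needs access to the top one.\<close>

lemma poly_vals_leading:
  "y \<in> poly_vals x (Suc n) \<Longrightarrow> \<exists>a\<in>J. \<exists>b\<in>poly_vals x n. y = a \<otimes> x [^] n \<oplus> b"
proof (induction n arbitrary: y)
  case (Suc n)
  obtain c d where y: "y = d \<otimes> x \<oplus> c" "c \<in> J" "d \<in> poly_vals x (Suc n)"
    using Suc.prems by (auto elim: poly_vals_SucE)
  obtain a b where ab: "a \<in> J" "b \<in> poly_vals x n" "d = a \<otimes> x [^] n \<oplus> b"
    using Suc.IH [OF y(3)] by blast
  have "y = a \<otimes> x [^] Suc n \<oplus> (b \<otimes> x \<oplus> c)"
    unfolding y(1) ab(3)
    using y(2) ab(1,2) poly_vals_carrier [OF ab(2)] x by (simp add: l_distr r_distr m_ac a_ac)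
  then show ?case
    using y ab by blast
qed (force elim!: poly_vals_SucE)

end

text \<open>Multiplication by x^n turns a polynomial of degree at most n in the inverse of x into
  the polynomial in x with reversed coefficients.\<close>

lemma poly_vals_reverse:
  assumes x: "x \<in> carrier E" "x \<noteq> \<zero>"
  shows "y \<in> poly_vals (inv x) (Suc n) \<Longrightarrow> x [^] n \<otimes> y \<in> poly_vals x (Suc n)"
proof (induction n arbitrary: y)
  case (Suc n)
  obtain a b where y: "y = b \<otimes> inv x \<oplus> a" "a \<in> J" "b \<in> poly_vals (inv x) (Suc n)"
    using Suc.prems by (auto elim: poly_vals_SucE)
  have b: "b \<in> carrier E"
    using poly_vals_carrier [OF _ y(3)] x by simp
  have "x [^] Suc n \<otimes> y = x [^] n \<otimes> b \<oplus> a \<otimes> x [^] Suc n"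
    unfolding y(1) using x y(2) b by (simp add: r_distr m_ac a_ac)
  moreover have "x [^] n \<otimes> b \<in> poly_vals x (Suc (Suc n))"
    using Suc.IH [OF y(3)] poly_vals_Suc x by blast
  moreover have "a \<otimes> x [^] Suc n \<in> poly_vals x (Suc (Suc n))"
    using poly_vals_pow x y(2) by blast
  ultimately show ?case
    using poly_vals_add x by metis
next
  case 0
  then show ?case
    using poly_vals_pow [of x y 0] x by (auto elim!: poly_vals_SucE)
qed

text \<open>
  The relation for \<open>x\<^sup>-\<^sup>1\<close> expresses a power \<open>x\<^sup>k\<close> through lower powers with coefficients in \<open>J\<close>
  (here \<open>1 - J\<close> has to consist of units), which lowers the degree of the relation for \<open>x\<close>.
\<close>

lemma poly_vals_reduce:
  assumes x: "x \<in> carrier E" "x \<noteq> \<zero>"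
    and units: "\<And>a. a \<in> J \<Longrightarrow> \<one> \<ominus> a \<noteq> \<zero> \<and> inv (\<one> \<ominus> a) \<in> S"
    and one: "\<one> \<in> poly_vals x (Suc n)" "\<one> \<in> poly_vals (inv x) (Suc k)"
    and "k \<le> n"
  shows "\<one> \<in> poly_vals x n"
proof -
  obtain c a where c: "\<one> = c \<otimes> inv x \<oplus> a" "a \<in> J" "c \<in> poly_vals (inv x) k"
    using one(2) by (auto elim: poly_vals_SucE)
  have c_carrier: "c \<in> carrier E"
    using poly_vals_carrier [OF _ c(3)] x by simp
  \<comment> \<open>If c vanished, 1 would lie in \<open>J\<close>, and 1 - 1 = 0 is no unit. As
    \<open>poly_vals\<close> at 0 contains only zero, it follows that k = l + 1.\<close>
  have "c \<noteq> \<zero>"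
  proof
    assume "c = \<zero>"
    then have "\<one> = a"
      using c(1,2) x by simp
    then show False
      using units [OF c(2)] r_neg [OF one_closed] by (simp add: minus_eq)
  qed
  then obtain l where k: "k = Suc l"
    using c(3) by (cases k) auto
  have eq: "\<one> \<ominus> a = c \<otimes> inv x"
    by (subst c(1)) (use c(2) c_carrier x in \<open>simp add: minus_eq a_assoc r_neg\<close>)
  \<comment> \<open>Multiplying 1 - a = c/x by x^k gives x^l c, which is a reversed polynomial with
    coefficients in \<open>J\<close>; dividing by the unit 1 - a keeps them in
    \<open>J\<close>.\<close>
  have "x [^] k = inv (\<one> \<ominus> a) \<otimes> (x [^] k \<otimes> (\<one> \<ominus> a))"
    using units [OF c(2)] c(2) x by (simp add: m_ac)
  also have "x [^] k \<otimes> (\<one> \<ominus> a) = x [^] l \<otimes> c"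
    unfolding eq k using x c_carrier by (simp add: m_ac)
  finally have "x [^] k \<in> poly_vals x k"
    using poly_vals_reverse [OF x c(3) [unfolded k]] units [OF c(2)] poly_vals_mult [OF x(1)] k
    by metis
  then have "x [^] (k + i) \<in> poly_vals x (k + i)" for i
  proof (induction i)
    case (Suc i)
    then show ?case
      using poly_vals_shift [OF x(1) Suc.IH] x by (simp add: m_comm)
  qed simp
  then have "x [^] n \<in> poly_vals x n"
    using \<open>k \<le> n\<close> by (metis le_add_diff_inverse)
  \<comment> \<open>Substituting the expression for x^n into the top term of the relation for x
    leaves a relation of degree less than n.\<close>
  moreover obtain a b where "a \<in> J" "b \<in> poly_vals x n" "\<one> = a \<otimes> x [^] n \<oplus> b"
    using poly_vals_leading [OF x(1) one(1)] by blast
  ultimately show ?thesis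
    using poly_vals_add poly_vals_mult x by (metis J_S)
qed

text \<open>Descent on n + k: the longer relation is shortened by means of the other one, with x and
  its inverse in symmetric roles. The descent cannot reach an empty relation because 1 is not
  0.\<close>

lemma poly_vals_not_both:
  assumes x: "x \<in> carrier E" "x \<noteq> \<zero>"
    and units: "\<And>a. a \<in> J \<Longrightarrow> \<one> \<ominus> a \<noteq> \<zero> \<and> inv (\<one> \<ominus> a) \<in> S"
    and one: "\<one> \<in> poly_vals x n" "\<one> \<in> poly_vals (inv x) k"
  shows False
  using x one
proof (induction "n + k" arbitrary: n k x rule: less_induct)
  case less
  have "n \<noteq> 0" "k \<noteq> 0"
    using less.prems by (auto intro!: gr0I)
  then obtain m l where ml: "n = Suc m" "k = Suc l"
    by (metis not0_implies_Suc)
  show False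
  proof (cases "l \<le> m")
    case True
    then have "\<one> \<in> poly_vals x m"
      using poly_vals_reduce [OF less.prems(1,2) units] less.prems ml by blast
    then show False
      using less.hyps [of m k x] less.prems ml by simp
  next
    case False
    have inv: "inv x \<in> carrier E" "inv x \<noteq> \<zero>" "inv (inv x) = x"
      using less.prems by simp_all
    have "\<one> \<in> poly_vals (inv x) l"
      using poly_vals_reduce [OF inv(1,2) units, of l m] less.prems ml inv(3) False by simp
    then show False
      using less.hyps [of n l x] less.prems ml by simp
  qed
qed

end

section \<open>The extension of the maximal ideal to a larger ring\<close>

context valued_field
begin

text \<open>The maximal ideal of the valuation ring.\<close>

definition M\<^sub>v :: "'a set" where
  "M\<^sub>v = {m \<in> K. m = \<zero> \<or> 0 < val m}"

lemma M_subset_O: "m \<in> M\<^sub>v \<Longrightarrow> m \<in> O\<^sub>v"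
  by (auto simp: M\<^sub>v_def mem_O_iff)

lemma M_carrier [simp]: "m \<in> M\<^sub>v \<Longrightarrow> m \<in> carrier E"
  by (simp add: M\<^sub>v_def)

lemma M_K: "m \<in> M\<^sub>v \<Longrightarrow> m \<in> K"
  by (simp add: M\<^sub>v_def)

text \<open>For nonzero elements, dividing the one of larger value by the other gives a quotient of
  nonnegative value; zero is a multiple of everything.\<close>

lemma O_dvd_linear:
  assumes "a \<in> K" "b \<in> K"
  shows "(\<exists>c\<in>O\<^sub>v. b = a \<otimes> c) \<or> (\<exists>c\<in>O\<^sub>v. a = b \<otimes> c)"
proof -
  have *: "\<exists>c\<in>O\<^sub>v. b = a \<otimes> c"
    if "a \<in> K" "b \<in> K" "a \<noteq> \<zero>" "b \<noteq> \<zero>" "val a \<le> val b" for a b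
    using that by (intro bexI [of _ "inv a \<otimes> b"]) (auto simp: mem_O_iff val_mult val_inv)
  show ?thesis
  proof (cases "a = \<zero> \<or> b = \<zero>")
    case True
    then show ?thesis
      using assms by (auto simp: mem_O_iff intro!: bexI [of _ \<zero>])
  next
    case False
    then show ?thesis
      using *[of a b] *[of b a] assms by (meson linear)
  qed
qed

text \<open>Single products stand in for finite sums of products: over a subring containing
  \<open>O\<^sub>v\<close> such sums collapse, as \<open>extended_ideal_add\<close> shows.\<close>

definition extended_ideal :: "'a set \<Rightarrow> 'a set" where
  "extended_ideal S = {m \<otimes> s | m s. m \<in> M\<^sub>v \<and> s \<in> S}"

lemma extended_idealI: "m \<in> M\<^sub>v \<Longrightarrow> s \<in> S \<Longrightarrow> m \<otimes> s \<in> extended_ideal S"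
  by (auto simp: extended_ideal_def)

lemma extended_idealE:
  assumes "a \<in> extended_ideal S"
  obtains m s where "a = m \<otimes> s" "m \<in> M\<^sub>v" "s \<in> S"
  using assms unfolding extended_ideal_def by blast

end

text \<open>Used twice: with the given ring \<open>R\<close> and with a maximal subring above
  it.\<close>

locale valued_extension = valued_field +
  fixes S :: "'a set"
  assumes S: "subring S E" and S_K: "S \<inter> K = O\<^sub>v"
begin

lemma O_S: "x \<in> O\<^sub>v \<Longrightarrow> x \<in> S"
  using S_K by blast

text \<open>Of the two factors from \<open>M\<^sub>v\<close> one divides the other inside
  \<open>O\<^sub>v\<close>, hence inside \<open>S\<close>, so the divisor can be factored out of the
  sum.\<close>

lemma extended_ideal_add:
  assumes "a \<in> extended_ideal S" "b \<in> extended_ideal S"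
  shows "a \<oplus> b \<in> extended_ideal S"
proof -
  note S_closed = subringE(5-7) [OF S] and S_carrier = subringE(1) [OF S, THEN subsetD]
  have *: "m \<otimes> s \<oplus> n \<otimes> t \<in> extended_ideal S"
    if "m \<in> M\<^sub>v" "s \<in> S" "t \<in> S" "c \<in> O\<^sub>v" "n = m \<otimes> c" for m n s t c
  proof -
    have "m \<otimes> s \<oplus> n \<otimes> t = m \<otimes> (s \<oplus> c \<otimes> t)"
      using that by (simp add: O_S S_carrier r_distr m_assoc)
    moreover have "s \<oplus> c \<otimes> t \<in> S"
      using that by (simp add: O_S S_closed)
    ultimately show ?thesis
      using that by (simp add: extended_idealI)
  qed
  obtain m s n t where ab: "a = m \<otimes> s" "b = n \<otimes> t" "m \<in> M\<^sub>v" "s \<in> S" "n \<in> M\<^sub>v" "t \<in> S"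
    using assms by (blast elim: extended_idealE)
  then consider c where "c \<in> O\<^sub>v" "n = m \<otimes> c" | c where "c \<in> O\<^sub>v" "m = n \<otimes> c"
    using O_dvd_linear [of m n] M_K by blast
  then show ?thesis
  proof cases
    case 1
    then show ?thesis
      using *[of m s t c n] ab by simp
  next
    case 2
    then show ?thesis
      using *[of n t s c m] ab by (simp add: a_comm S_carrier)
  qed
qed

sublocale subring_ideal E S "extended_ideal S"
proof (rule subring_ideal.intro [OF field_axioms subring_ideal_axioms.intro])
  note S_closed = subringE(2,3,5-7) [OF S] and S_carrier = subringE(1) [OF S, THEN subsetD]
  show "subring S E"
    by (rule S)
  show "extended_ideal S \<subseteq> S"
    using S_closed(4) O_S [OF M_subset_O] by (blast elim: extended_idealE)
  show "\<zero> \<in> extended_ideal S"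
    using extended_idealI [of \<zero> \<zero> S] S_closed by (simp add: M\<^sub>v_def)
  show "a \<oplus> b \<in> extended_ideal S" if "a \<in> extended_ideal S" "b \<in> extended_ideal S" for a b
    using that by (rule extended_ideal_add)
  fix s a assume s: "s \<in> S" "a \<in> extended_ideal S"
  then obtain m t where "a = m \<otimes> t" "m \<in> M\<^sub>v" "t \<in> S"
    by (blast elim: extended_idealE)
  moreover from this s have "s \<otimes> a = m \<otimes> (s \<otimes> t)"
    by (simp add: S_carrier m_lcomm)
  ultimately show "s \<otimes> a \<in> extended_ideal S"
    using s S_closed by (simp add: extended_idealI)
qed

lemma one_notin_extended_ideal: "\<one> \<notin> extended_ideal S"
proof
  assume "\<one> \<in> extended_ideal S"
  then obtain m s where ms: "\<one> = m \<otimes> s" "m \<in> M\<^sub>v" "s \<in> S"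
    by (rule extended_idealE)
  have m: "m \<noteq> \<zero>" "0 < val m"
    using ms(2) ms(1) [symmetric] ms(3) subringE(1) [OF S] by (auto simp: M\<^sub>v_def)
  have "inv m = inv m \<otimes> (m \<otimes> s)"
    using ms m by (simp flip: ms(1))
  then have "s = inv m"
    using ms(2,3) m by simp
  then have "inv m \<in> O\<^sub>v"
    using S_K ms(3) K_inv [OF M_K [OF ms(2)] m(1)] by blast
  then show False
    using m M_K [OF ms(2)] by (auto simp: mem_O_iff val_inv)
qed

text \<open>An element of S[x] is a polynomial in x over \<open>S\<close>; a factor from
  \<open>M\<^sub>v\<close> moves its coefficients into the extended ideal. This is how an element of
  S[x] in \<open>K\<close> of negative value will yield a relation for 1.\<close>

lemma mult_simple_extension_poly_vals:
  assumes x: "x \<in> carrier E" and "y \<in> simple_extension S x"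
  shows "\<exists>n. \<forall>m\<in>M\<^sub>v. m \<otimes> y \<in> poly_vals x n"
  using assms(2)
proof induction
  case zero
  show ?case
    by (intro exI [of _ 0]) simp
next
  case (lin y s)
  then obtain n where n: "\<forall>m\<in>M\<^sub>v. m \<otimes> y \<in> poly_vals x n"
    by blast
  have y: "y \<in> carrier E"
    using lin(1) simple_extension_in_carrier [OF subringE(1) [OF S] x] by blast
  have "m \<otimes> (y \<otimes> x \<oplus> s) \<in> poly_vals x (Suc n)" if m: "m \<in> M\<^sub>v" for m
  proof -
    have "m \<otimes> (y \<otimes> x \<oplus> s) = (m \<otimes> y) \<otimes> x \<oplus> m \<otimes> s"
      using m x y lin(2) by (simp add: r_distr m_assoc)
    moreover have "m \<otimes> s \<in> extended_ideal S"
      using m lin(2) by (rule extended_idealI)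
    ultimately show ?thesis
      using n m by (simp add: poly_vals_SucI)
  qed
  then show ?case by blast
qed

end

text \<open>Zorn's lemma: any two elements of the union of a chain lie in a common member, so the
  union is a subring, and it still meets \<open>K\<close> in \<open>O\<^sub>v\<close>.\<close>

lemma (in valued_field) maximal_subring_exists:
  assumes R: "subring R E" "R \<inter> K = O\<^sub>v"
  obtains S where "subring S E" "R \<subseteq> S" "S \<inter> K = O\<^sub>v"
    "\<And>T. subring T E \<Longrightarrow> S \<subseteq> T \<Longrightarrow> T \<inter> K = O\<^sub>v \<Longrightarrow> T = S"
proof -
  let ?A = "{S. subring S E \<and> R \<subseteq> S \<and> S \<inter> K = O\<^sub>v}"
  have "\<exists>S\<in>?A. \<forall>T\<in>?A. S \<subseteq> T \<longrightarrow> T = S"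
  proof (rule subset_Zorn_nonempty)
    show "?A \<noteq> {}"
      using R by blast
    fix C assume C: "C \<noteq> {}" "subset.chain ?A C"
    then have sub: "subring S E" "R \<subseteq> S" "S \<inter> K = O\<^sub>v" if "S \<in> C" for S
      using that by (auto simp: subset.chain_def)
    have "subring (\<Union>C) E"
    proof (rule subringI)
      show "\<Union>C \<subseteq> carrier E" "\<one> \<in> \<Union>C"
        using subringE(1,3) [OF sub(1)] C(1) by blast+
      fix x assume "x \<in> \<Union>C"
      then obtain S where S: "S \<in> C" "x \<in> S"
        by blast
      then show "\<ominus> x \<in> \<Union>C"
        using subringE(5) [OF sub(1)] by blast
      fix y assume "y \<in> \<Union>C"
      then obtain T where T: "T \<in> C" "y \<in> T"
        by blast
      have "S \<subseteq> T \<or> T \<subseteq> S"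
        using C(2) S(1) T(1) unfolding subset.chain_def by blast
      then obtain U where "U \<in> C" "x \<in> U" "y \<in> U"
        using S T by blast
      then show "x \<otimes> y \<in> \<Union>C" "x \<oplus> y \<in> \<Union>C"
        using subringE(6,7) [OF sub(1)] by blast+
    qed
    moreover have "R \<subseteq> \<Union>C" "\<Union>C \<inter> K = O\<^sub>v"
      using sub(2,3) C(1) by blast+
    ultimately show "\<Union>C \<in> ?A"
      by blast
  qed
  then show thesis
    using that by fastforce
qed

section \<open>A maximal subring is a valuation ring\<close>

locale maximal_valued_extension = valued_extension +
  assumes maximal: "\<And>T. subring T E \<Longrightarrow> S \<subseteq> T \<Longrightarrow> T \<inter> K = O\<^sub>v \<Longrightarrow> T = S"
begin

text \<open>By maximality S[x] contains some f in \<open>K\<close> of negative value. Its inverse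
  lies in \<open>M\<^sub>v\<close>, and multiplying f by it moves the coefficients into the ideal
  while producing 1.\<close>

lemma one_mem_poly_vals:
  assumes x: "x \<in> carrier E" "x \<notin> S"
  shows "\<exists>n. \<one> \<in> poly_vals x n"
proof -
  let ?T = "simple_extension S x"
  have "subring ?T E" "x \<in> ?T" "S \<subseteq> ?T"
    using simple_extension_is_subring [OF S x(1)] simple_extension_mem [OF S x(1)]
      simple_extension_incl [OF subringE(1) [OF S] x(1)] .
  then have "?T \<inter> K \<noteq> O\<^sub>v"
    using maximal x by blast
  then obtain f where f: "f \<in> ?T" "f \<in> K" "f \<notin> O\<^sub>v"
    using \<open>S \<subseteq> ?T\<close> S_K by blast
  have "f \<noteq> \<zero>" "val f < 0"
    using f by (auto simp: mem_O_iff)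
  then have "inv f \<in> M\<^sub>v"
    using f by (simp add: M\<^sub>v_def val_inv)
  moreover have "inv f \<otimes> f = \<one>"
    using f \<open>f \<noteq> \<zero>\<close> by simp
  ultimately show ?thesis
    using mult_simple_extension_poly_vals [OF x(1) f(1)] by fastforce
qed

text \<open>Put s = 1 - a. If the inverse of s were outside \<open>S\<close>, it would satisfy a
  relation for 1; clearing denominators puts a power of s into the ideal. But s is congruent to 1
  modulo the ideal, so 1 would lie in it as well.\<close>

lemma one_minus_unit:
  assumes a: "a \<in> extended_ideal S"
  shows "\<one> \<ominus> a \<noteq> \<zero> \<and> inv (\<one> \<ominus> a) \<in> S"
proof -
  define s where "s = \<one> \<ominus> a"
  have s: "s \<in> S" "\<one> = s \<oplus> a"
    using a by (simp_all add: s_def minus_eq a_assoc l_neg)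
  have "s \<noteq> \<zero>"
    using s a one_notin_extended_ideal by auto
  moreover have "inv s \<in> S"
  proof (rule ccontr)
    assume "inv s \<notin> S"
    then obtain n where n: "\<one> \<in> poly_vals (inv s) n"
      using one_mem_poly_vals [of "inv s"] s(1) \<open>s \<noteq> \<zero>\<close> by auto
    have pow: "s [^] n \<in> S" for n :: nat
      using s(1) by (induction n) auto
    have "s [^] n \<otimes> y \<in> extended_ideal S" if "y \<in> poly_vals (inv s) n" for y n
      using that
    proof (induction n arbitrary: y)
      case (Suc n)
      obtain c b where y: "y = b \<otimes> inv s \<oplus> c" "c \<in> extended_ideal S" "b \<in> poly_vals (inv s) n"
        using Suc.prems by (rule poly_vals_SucE)
      have "b \<in> carrier E"
        using poly_vals_carrier [OF _ y(3)] s(1) \<open>s \<noteq> \<zero>\<close> by simp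
      then have "s [^] Suc n \<otimes> y = s [^] n \<otimes> b \<oplus> s [^] Suc n \<otimes> c"
        unfolding y(1) using y(2) s(1) \<open>s \<noteq> \<zero>\<close> by (simp add: r_distr m_ac)
      then show ?case
        using Suc.IH [OF y(3)] y(2) mult_J [OF pow [of "Suc n"]] by simp
    qed simp
    from this [OF n] have "s [^] n \<in> extended_ideal S"
      using s(1) by simp
    then have "\<one> \<in> extended_ideal S"
    proof (induction n)
      case (Suc n)
      \<comment> \<open>Since 1 = s + a, membership of s^(n+1) in the ideal passes down to s^n, and
        finally to s^0 = 1.\<close>
      have "s [^] n = s [^] n \<otimes> (s \<oplus> a)"
        using s(1) by (simp flip: s(2))
      also have "\<dots> = s [^] Suc n \<oplus> s [^] n \<otimes> a"
        using s(1) a by (simp add: r_distr)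
      also have "\<dots> \<in> extended_ideal S"
        by (rule add_J [OF Suc.prems mult_J [OF pow a]])
      finally show ?case
        by (rule Suc.IH)
    qed simp
    then show False
      using one_notin_extended_ideal by blast
  qed
  ultimately show ?thesis
    by (simp add: s_def)
qed

lemma mem_or_inv_mem:
  assumes x: "x \<in> carrier E" "x \<noteq> \<zero>"
  shows "x \<in> S \<or> inv x \<in> S"
proof (rule ccontr)
  assume "\<not> ?thesis"
  then obtain n k where "\<one> \<in> poly_vals x n" "\<one> \<in> poly_vals (inv x) k"
    using one_mem_poly_vals [of x] one_mem_poly_vals [of "inv x"] x by auto
  then show False
    using poly_vals_not_both [OF x one_minus_unit] by blast
qed

end

section \<open>The valuation of a valuation ring in an algebraic extension\<close>

locale algebraic_valuation_ring = valued_extension E K v S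
  for E :: "('a, 'e) ring_scheme" (structure) and K
    and v :: "'a \<Rightarrow> 'g::linordered_ab_group_add top" and S +
  assumes mem_or_inv_mem: "x \<in> carrier E \<Longrightarrow> x \<noteq> \<zero> \<Longrightarrow> x \<in> S \<or> inv x \<in> S"
    and algebraic: "x \<in> carrier E \<Longrightarrow> (algebraic over K) x"
begin

section \<open>Units of the valuation ring and sums of terms of different value\<close>

definition S_units :: "'a set" where
  "S_units = {e \<in> S. e \<noteq> \<zero> \<and> inv e \<in> S}"

lemma unitD: "e \<in> S_units \<Longrightarrow> e \<in> S" "e \<in> S_units \<Longrightarrow> e \<in> carrier E" "e \<in> S_units \<Longrightarrow> e \<noteq> \<zero>"
  "e \<in> S_units \<Longrightarrow> inv e \<in> S"
  by (auto simp: S_units_def)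

lemma one_unit: "\<one> \<in> S_units"
  by (simp add: S_units_def)

lemma mult_unit: "e \<in> S_units \<Longrightarrow> f \<in> S_units \<Longrightarrow> e \<otimes> f \<in> S_units"
  by (auto simp: S_units_def inv_mult_nonzero)

lemma inv_unit: "e \<in> S_units \<Longrightarrow> inv e \<in> S_units"
  by (auto simp: S_units_def)

lemma pow_unit: "e \<in> S_units \<Longrightarrow> e [^] (n::nat) \<in> S_units"
  by (induction n) (auto simp: one_unit mult_unit)

lemma val_unit:
  assumes "e \<in> S_units" "e \<in> K"
  shows "val e = 0"
proof -
  have e: "e \<in> S" "inv e \<in> S" "e \<noteq> \<zero>"
    using assms(1) by (auto simp: S_units_def)
  then have "e \<in> O\<^sub>v" "inv e \<in> O\<^sub>v"
    unfolding S_K [symmetric] using assms(2) by auto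
  then show ?thesis
    using assms(2) e(3) by (auto simp: mem_O_iff val_inv)
qed

text \<open>The quotient a/b = f/e is a unit of \<open>S\<close> lying in \<open>K\<close>, so its
  value is 0.\<close>

lemma val_cong_unit:
  assumes "a \<in> K" "a \<noteq> \<zero>" "b \<in> K" "b \<noteq> \<zero>" "e \<in> S_units" "f \<in> S_units"
    and eq: "a \<otimes> e = b \<otimes> f"
  shows "val a = val b"
proof -
  note [simp] = unitD
  have "inv b \<otimes> a = inv b \<otimes> ((a \<otimes> e) \<otimes> inv e)"
    using assms(1-6) by (simp add: m_assoc)
  also have "\<dots> = f \<otimes> inv e"
    unfolding eq using assms(1-6) by (simp add: m_assoc)
  finally have "inv b \<otimes> a \<in> S_units"
    using assms by (simp add: mult_unit inv_unit)
  then have "val (inv b \<otimes> a) = 0"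
    using assms by (intro val_unit) auto
  then show ?thesis
    using assms by (simp add: val_mult val_inv)
qed

text \<open>Here z is a nonunit of \<open>S\<close>. The quotient (1 + z)/z = 1/z + 1 lies outside
  \<open>S\<close>, so its inverse z/(1 + z) lies in \<open>S\<close>, and 1/(1 + z) = 1 - z/(1 +
  z).\<close>

lemma one_plus_unit:
  assumes z: "z \<in> carrier E" "z \<noteq> \<zero>" "z \<in> S" "inv z \<notin> S"
  shows "\<one> \<oplus> z \<in> S_units"
proof -
  \<comment> \<open>1 + z = 0 would give z = -1, which is its own inverse, so that the inverse of z
    would lie in \<open>S\<close>.\<close>
  have nz: "\<one> \<oplus> z \<noteq> \<zero>"
  proof
    assume "\<one> \<oplus> z = \<zero>"
    then have "z = \<ominus> \<one>"
      using z by (metis minus_equality a_comm one_closed)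
    moreover have "inv (\<ominus> \<one>) = \<ominus> \<one>"
      by (rule comm_inv_char) (simp_all add: l_minus r_minus)
    ultimately show False
      using z by simp
  qed
  define w where "w = inv z \<otimes> (\<one> \<oplus> z)"
  have "w = inv z \<oplus> \<one>"
    using z by (simp add: w_def r_distr)
  have "w \<notin> S"
  proof
    assume "w \<in> S"
    then have "w \<oplus> \<ominus> \<one> \<in> S"
      by simp
    then show False
      using \<open>w = inv z \<oplus> \<one>\<close> z by (simp add: a_assoc r_neg)
  qed
  then have "inv w \<in> S"
    using mem_or_inv_mem [of w] z nz by (auto simp: w_def)
  moreover have "inv w = z \<otimes> inv (\<one> \<oplus> z)"
    using z nz by (simp add: w_def inv_mult_nonzero)
  moreover have "inv (\<one> \<oplus> z) = \<one> \<oplus> \<ominus> (z \<otimes> inv (\<one> \<oplus> z))"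
  proof -
    have "\<one> = (\<one> \<oplus> z) \<otimes> inv (\<one> \<oplus> z)"
      using z nz by simp
    also have "\<dots> = inv (\<one> \<oplus> z) \<oplus> z \<otimes> inv (\<one> \<oplus> z)"
      by (subst l_distr) (use z nz in auto)
    finally have "\<one> \<oplus> \<ominus> (z \<otimes> inv (\<one> \<oplus> z)) =
        inv (\<one> \<oplus> z) \<oplus> z \<otimes> inv (\<one> \<oplus> z) \<oplus> \<ominus> (z \<otimes> inv (\<one> \<oplus> z))"
      by (rule arg_cong)
    also have "\<dots> = inv (\<one> \<oplus> z)"
      using z nz by (simp add: a_assoc r_neg)
    finally show ?thesis ..
  qed
  ultimately have "inv (\<one> \<oplus> z) \<in> S"
    by (metis S_closed(2,3,5))
  then show ?thesis
    using z nz by (simp add: S_units_def)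
qed

text \<open>Since \<open>S\<close> is a valuation ring, one of the quotients y/x and x/y lies in
  \<open>S\<close>. It is a nonunit there, so factoring out its denominator leaves 1 plus a
  nonunit.\<close>

lemma add_dominant:
  assumes x: "x \<in> carrier E" "x \<noteq> \<zero>" and y: "y \<in> carrier E" "y \<noteq> \<zero>"
    and "inv x \<otimes> y \<notin> S_units"
  shows "\<exists>e\<in>S_units. x \<oplus> y = x \<otimes> e \<or> x \<oplus> y = y \<otimes> e"
proof (cases "inv x \<otimes> y \<in> S")
  case True
  then have "\<one> \<oplus> inv x \<otimes> y \<in> S_units"
    using assms by (intro one_plus_unit) (auto simp: S_units_def)
  moreover have "x \<oplus> y = x \<otimes> (\<one> \<oplus> inv x \<otimes> y)"
    using x y by (simp add: r_distr)
  ultimately show ?thesis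
    by blast
next
  case False
  have inv: "inv (inv x \<otimes> y) = inv y \<otimes> x" "inv (inv y \<otimes> x) = inv x \<otimes> y"
    using x y by (simp_all add: inv_mult_nonzero m_comm)
  then have "inv y \<otimes> x \<in> S"
    using False mem_or_inv_mem [of "inv x \<otimes> y"] x y by auto
  then have "\<one> \<oplus> inv y \<otimes> x \<in> S_units"
    using False x y inv by (intro one_plus_unit) auto
  moreover have "x \<oplus> y = y \<otimes> (\<one> \<oplus> inv y \<otimes> x)"
    using x y by (simp add: r_distr a_comm)
  ultimately show ?thesis
    by blast
qed

section \<open>Powers of an element as products of base field elements and units\<close>

lemma eval_all_zero:
  "x \<in> carrier E \<Longrightarrow> set p \<subseteq> {\<zero>} \<Longrightarrow> eval p x = \<zero>"
  by (induction p) auto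

text \<open>Without a relation x^n = a e, nonzero monomials of different degrees have different
  \<open>S\<close>-values. So each time a leading monomial is added, one summand dominates and the
  sum is that summand times a unit.\<close>

lemma eval_eq_monomial:
  assumes x: "x \<in> carrier E" "x \<noteq> \<zero>"
    and no_rel: "\<And>n a e. 0 < n \<Longrightarrow> a \<in> K \<Longrightarrow> a \<noteq> \<zero> \<Longrightarrow> e \<in> S_units \<Longrightarrow> x [^] (n::nat) \<noteq> a \<otimes> e"
    and p: "set p \<subseteq> K" "\<not> set p \<subseteq> {\<zero>}"
  shows "\<exists>c\<in>K. \<exists>i<length p. \<exists>e\<in>S_units. c \<noteq> \<zero> \<and> eval p x = c \<otimes> x [^] i \<otimes> e"
  using p
proof (induction p)
  case (Cons a p)
  note [simp] = unitD nat_pow_nonzero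
  let ?n = "length p"
  have a: "a \<in> K" and p_carrier: "set p \<subseteq> carrier E"
    using Cons.prems(1) by auto
  have eval_carrier: "eval p x \<in> carrier E"
    using eval_in_carrier [OF p_carrier] x by blast
  have eval: "eval (a # p) x = a \<otimes> x [^] ?n \<oplus> eval p x"
    by simp
  consider "a = \<zero>" | "a \<noteq> \<zero>" "set p \<subseteq> {\<zero>}" | "a \<noteq> \<zero>" "\<not> set p \<subseteq> {\<zero>}"
    by blast
  then show ?case
  proof cases
    case 1
    then have "eval (a # p) x = eval p x"
      using x eval_carrier by (simp add: eval)
    moreover obtain c i e where "c \<in> K" "i < length p" "e \<in> S_units" "c \<noteq> \<zero>"
      "eval p x = c \<otimes> x [^] i \<otimes> e"
      using Cons 1 by auto
    ultimately show ?thesis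
      by (metis length_Cons less_Suc_eq)
  next
    case 2
    then have "eval (a # p) x = a \<otimes> x [^] ?n \<otimes> \<one>"
      using a x eval_all_zero by (simp add: eval)
    then show ?thesis
      using a 2 one_unit by (metis length_Cons lessI)
  next
    case 3
    obtain c i e where c: "c \<in> K" "i < ?n" "e \<in> S_units" "c \<noteq> \<zero>"
      "eval p x = c \<otimes> x [^] i \<otimes> e"
      using Cons 3 by auto
    define Z where "Z = a \<otimes> x [^] ?n"
    have Z: "Z \<in> carrier E" "Z \<noteq> \<zero>"
      using a 3 x by (auto simp: Z_def)
    have Y: "eval p x \<noteq> \<zero>"
      using c x by auto
    \<comment> \<open>If both summands had the same \<open>S\<close>-value, cancelling x^i would
      leave c e = a x^j f, that is x^j = (c/a)(e/f). Here j is positive because i is smaller than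
      the degree of the leading monomial, so \<open>no_rel\<close> forbids this.\<close>
    have "inv Z \<otimes> eval p x \<notin> S_units"
    proof
      assume f: "inv Z \<otimes> eval p x \<in> S_units"
      define f where "f = inv Z \<otimes> eval p x"
      have f: "f \<in> S_units" "eval p x = Z \<otimes> f"
        using f Z eval_carrier by (simp_all add: f_def)
      define j where "j = ?n - i"
      have j: "0 < j" "?n = i + j"
        using c(2) by (simp_all add: j_def)
      have "x [^] i \<otimes> (c \<otimes> e) = x [^] i \<otimes> (a \<otimes> x [^] j \<otimes> f)"
        using f(2) unfolding c(5) Z_def j(2) using x a c f(1)
        by (simp add: m_ac flip: nat_pow_mult)
      then have eq: "c \<otimes> e = a \<otimes> x [^] j \<otimes> f"
        using x a c f(1) by (subst (asm) m_lcancel) auto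
      have "x [^] j = inv a \<otimes> (a \<otimes> x [^] j \<otimes> f) \<otimes> inv f"
        using x a 3(1) f(1) by (simp add: m_assoc)
      also have "\<dots> = (inv a \<otimes> c) \<otimes> (e \<otimes> inv f)"
        using x a 3(1) f(1) c by (simp add: m_assoc flip: eq)
      finally show False
        using no_rel [OF j(1), of "inv a \<otimes> c" "e \<otimes> inv f"] a 3(1) f(1) c
        by (simp add: mult_unit inv_unit)
    qed
    then obtain g where g: "g \<in> S_units"
      "eval (a # p) x = Z \<otimes> g \<or> eval (a # p) x = eval p x \<otimes> g"
      using add_dominant [OF Z eval_carrier Y] by (auto simp: eval Z_def)
    from g(2) show ?thesis
    proof
      assume "eval (a # p) x = Z \<otimes> g"
      then show ?thesis
        using a 3 g(1) unfolding Z_def by (metis length_Cons lessI)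
    next
      assume "eval (a # p) x = eval p x \<otimes> g"
      then have "eval (a # p) x = c \<otimes> x [^] i \<otimes> (e \<otimes> g)"
        using c g(1) x by (simp add: m_assoc)
      then show ?thesis
        using c mult_unit [OF c(3) g(1)] by (metis length_Cons less_SucI)
    qed
  qed
qed simp

text \<open>Otherwise the value at x of a nonzero polynomial vanishing there would be a product of
  nonzero factors.\<close>

lemma pow_eq_mult_unit:
  assumes x: "x \<in> carrier E" "x \<noteq> \<zero>"
  shows "\<exists>n>0. \<exists>a\<in>K. \<exists>e\<in>S_units. a \<noteq> \<zero> \<and> x [^] (n::nat) = a \<otimes> e"
proof (rule ccontr)
  assume neg: "\<not> ?thesis"
  obtain p where p: "p \<in> carrier (K[X])" "p \<noteq> []" "eval p x = \<zero>"
    using algebraicE [OF subfieldE(1) [OF K] x(1) algebraic [OF x(1)]] by blast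
  have p_K: "set p \<subseteq> K" and "lead_coeff p \<noteq> \<zero>"
    using p(1,2) unfolding univ_poly_carrier [symmetric] polynomial_def by auto
  then have p_nz: "\<not> set p \<subseteq> {\<zero>}"
    using hd_in_set [OF p(2)] by blast
  have no_rel: "x [^] n \<noteq> a \<otimes> e"
    if "0 < n" "a \<in> K" "a \<noteq> \<zero>" "e \<in> S_units" for n :: nat and a e
    using neg that by blast
  have "\<exists>c\<in>K. \<exists>i<length p. \<exists>e\<in>S_units. c \<noteq> \<zero> \<and> eval p x = c \<otimes> x [^] i \<otimes> e"
    by (rule eval_eq_monomial [OF x _ p_K p_nz]) (rule no_rel)
  then obtain c e and i :: nat
    where c: "c \<in> K" "e \<in> S_units" "c \<noteq> \<zero>" "eval p x = c \<otimes> x [^] i \<otimes> e"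
    by blast
  have "c \<otimes> x [^] i \<otimes> e \<noteq> \<zero>"
    using c(1-3) x by (simp add: unitD nat_pow_nonzero)
  then show False
    using c(4) p(3) by simp
qed

text \<open>A relation x^n = a e forces the value v(a)/n. Keeping it as a relation leaves n, a and e
  free to be chosen in each proof until uniqueness is known.\<close>

definition has_value :: "'a \<Rightarrow> 'g div_hull \<Rightarrow> bool" where
  "has_value x q \<longleftrightarrow> (\<exists>n>0. \<exists>a\<in>K. \<exists>e\<in>S_units.
     a \<noteq> \<zero> \<and> x [^] n = a \<otimes> e \<and> nmult n q = to_div_hull (val a))"

lemma has_value_exists:
  assumes "x \<in> carrier E" "x \<noteq> \<zero>"
  shows "\<exists>q. has_value x q"
proof -
  obtain n :: nat and a e
    where "0 < n" "a \<in> K" "a \<noteq> \<zero>" "e \<in> S_units" "x [^] n = a \<otimes> e"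
    using pow_eq_mult_unit [OF assms] by blast
  moreover obtain q where "nmult n q = to_div_hull (val a)"
    using to_div_hull_divisible \<open>0 < n\<close> .
  ultimately show ?thesis
    unfolding has_value_def by blast
qed

text \<open>Raising the relations for x^n and x^m to the powers m and n makes their right-hand sides
  equal. Comparing values in \<open>K\<close> gives m v(a) = n v(b), and the divisible hull is
  torsion-free.\<close>

lemma has_value_unique:
  assumes x: "x \<in> carrier E" and "has_value x q" "has_value x r"
  shows "q = r"
proof -
  obtain n a e where n: "0 < n" "a \<in> K" "e \<in> S_units" "a \<noteq> \<zero>" "x [^] n = a \<otimes> e"
      "nmult n q = to_div_hull (val a)"
    using assms(2) unfolding has_value_def by blast
  obtain m b f where m: "0 < m" "b \<in> K" "f \<in> S_units" "b \<noteq> \<zero>" "x [^] m = b \<otimes> f"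
      "nmult m r = to_div_hull (val b)"
    using assms(3) unfolding has_value_def by blast
  have "(x [^] n) [^] m = (x [^] m) [^] n"
    using x by (simp add: nat_pow_pow mult.commute)
  then have "a [^] m \<otimes> e [^] m = b [^] n \<otimes> f [^] n"
    using n(2-5) m(2-5) by (simp add: nat_pow_distrib unitD)
  then have "val (a [^] m) = val (b [^] n)"
    using n m by (intro val_cong_unit [of _ _ "e [^] m" "f [^] n"])
      (simp_all add: pow_unit nat_pow_nonzero)
  then have "nmult m (val a) = nmult n (val b)"
    using n m by (simp add: val_pow)
  then have "nmult m (nmult n q) = nmult n (nmult m r)"
    using n m by (simp flip: to_div_hull_nmult)
  then have "nmult (m * n) q = nmult (m * n) r"
    by (simp add: nmult_nmult mult.commute)
  then show ?thesis
    using n m by (simp add: nmult_eq_iff)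
qed

lemma has_value_mult:
  assumes xy: "x \<in> carrier E" "y \<in> carrier E" and "has_value x q" "has_value y r"
  shows "has_value (x \<otimes> y) (q + r)"
proof -
  obtain n a e where n: "0 < n" "a \<in> K" "e \<in> S_units" "a \<noteq> \<zero>" "x [^] n = a \<otimes> e"
      "nmult n q = to_div_hull (val a)"
    using assms(3) unfolding has_value_def by blast
  obtain m b f where m: "0 < m" "b \<in> K" "f \<in> S_units" "b \<noteq> \<zero>" "y [^] m = b \<otimes> f"
      "nmult m r = to_div_hull (val b)"
    using assms(4) unfolding has_value_def by blast
  have "(x \<otimes> y) [^] (n * m) = (x [^] n) [^] m \<otimes> (y [^] m) [^] n"
    using xy by (simp add: nat_pow_distrib nat_pow_pow mult.commute)
  also have "\<dots> = (a [^] m \<otimes> b [^] n) \<otimes> (e [^] m \<otimes> f [^] n)"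
    unfolding n(5) m(5) using n(2-4) m(2-4) by (simp add: nat_pow_distrib unitD m_ac)
  finally have "(x \<otimes> y) [^] (n * m) = (a [^] m \<otimes> b [^] n) \<otimes> (e [^] m \<otimes> f [^] n)" .
  moreover have "nmult (n * m) (q + r) = nmult m (nmult n q) + nmult n (nmult m r)"
    by (simp add: nmult_add nmult_nmult mult.commute)
  then have "nmult (n * m) (q + r) = to_div_hull (val (a [^] m \<otimes> b [^] n))"
    using n m by (simp add: val_mult val_pow nat_pow_nonzero to_div_hull_add to_div_hull_nmult)
  moreover have "a [^] m \<otimes> b [^] n \<in> K" "a [^] m \<otimes> b [^] n \<noteq> \<zero>"
    using n m by (simp_all add: nat_pow_nonzero)
  moreover have "e [^] m \<otimes> f [^] n \<in> S_units"
    using n m by (simp add: pow_unit mult_unit)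
  moreover have "0 < n * m"
    using n m by simp
  ultimately show ?thesis
    unfolding has_value_def by blast
qed

text \<open>The element a = x^n / e lies in both \<open>S\<close> and \<open>K\<close>, hence in
  \<open>O\<^sub>v\<close>.\<close>

lemma has_value_nonneg:
  assumes "x \<in> S" "has_value x q"
  shows "0 \<le> q"
proof -
  obtain n a e where n: "0 < n" "a \<in> K" "e \<in> S_units" "a \<noteq> \<zero>" "x [^] n = a \<otimes> e"
      "nmult n q = to_div_hull (val a)"
    using assms(2) unfolding has_value_def by blast
  have pow: "x [^] n \<in> S" for n :: nat
    using assms(1) by (induction n) auto
  have "a = x [^] n \<otimes> inv e"
    unfolding n(5) using n(2-4) by (simp add: unitD m_assoc)
  then have "a \<in> S"
    using pow [of n] unitD(4) [OF n(3)] by (simp only: S_closed(4))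
  then have "a \<in> O\<^sub>v"
    using n(2) S_K by blast
  then have "0 \<le> val a"
    using n(4) by (simp add: mem_O_iff)
  then have "0 \<le> nmult n q"
    unfolding n(6) to_div_hull_0 [symmetric] to_div_hull_le_iff .
  then show ?thesis
    using n(1) by (simp add: nmult_nonneg_iff)
qed

section \<open>The valuation extending v\<close>

definition u_val :: "'a \<Rightarrow> 'g div_hull" where
  "u_val x = (THE q. has_value x q)"

lemma has_value_u_val: "x \<in> carrier E \<Longrightarrow> x \<noteq> \<zero> \<Longrightarrow> has_value x (u_val x)"
  unfolding u_val_def using has_value_exists has_value_unique by (metis theI')

lemma u_val_eqI: "x \<in> carrier E \<Longrightarrow> has_value x q \<Longrightarrow> u_val x = q"
  unfolding u_val_def using has_value_unique by blast

lemma u_val_mult: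
  assumes "x \<in> carrier E" "x \<noteq> \<zero>" "y \<in> carrier E" "y \<noteq> \<zero>"
  shows "u_val (x \<otimes> y) = u_val x + u_val y"
  using assms by (intro u_val_eqI has_value_mult has_value_u_val) auto

lemma u_val_nonneg: "x \<in> S \<Longrightarrow> x \<noteq> \<zero> \<Longrightarrow> 0 \<le> u_val x"
  using has_value_nonneg has_value_u_val by auto

text \<open>After factoring out x, the cofactor lies in \<open>S\<close>. As y/x or x/y always lies
  in \<open>S\<close>, the ultrametric inequality will follow by symmetry.\<close>

lemma u_val_add_le:
  assumes x: "x \<in> carrier E" "x \<noteq> \<zero>" and y: "y \<in> carrier E" and "inv x \<otimes> y \<in> S" "x \<oplus> y \<noteq> \<zero>"
  shows "u_val x \<le> u_val (x \<oplus> y)"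
proof -
  have eq: "x \<oplus> y = x \<otimes> (\<one> \<oplus> inv x \<otimes> y)"
    using x y by (simp add: r_distr)
  have nz: "\<one> \<oplus> inv x \<otimes> y \<noteq> \<zero>"
    using assms eq by auto
  have "0 \<le> u_val (\<one> \<oplus> inv x \<otimes> y)"
    using nz assms(4) by (intro u_val_nonneg) auto
  then show ?thesis
    unfolding eq using nz x y by (subst u_val_mult) auto
qed

lemma u_val_add:
  assumes x: "x \<in> carrier E" "x \<noteq> \<zero>" and y: "y \<in> carrier E" "y \<noteq> \<zero>" and "x \<oplus> y \<noteq> \<zero>"
  shows "min (u_val x) (u_val y) \<le> u_val (x \<oplus> y)"
proof (cases "inv x \<otimes> y \<in> S")
  case True
  then show ?thesis
    using u_val_add_le [of x y] assms by (simp add: min.coboundedI1)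
next
  case False
  have "inv (inv x \<otimes> y) = inv y \<otimes> x"
    using x y by (simp add: inv_mult_nonzero m_comm)
  then have "inv y \<otimes> x \<in> S"
    using False mem_or_inv_mem [of "inv x \<otimes> y"] x y by auto
  then show ?thesis
    using u_val_add_le [of y x] assms by (simp add: min.coboundedI2 a_comm)
qed

lemma u_val_K:
  assumes "x \<in> K" "x \<noteq> \<zero>"
  shows "u_val x = to_div_hull (val x)"
proof (rule u_val_eqI)
  show "has_value x (to_div_hull (val x))"
    unfolding has_value_def using assms one_unit
    by (intro exI [of _ 1] conjI bexI [of _ x] bexI [of _ \<one>]) auto
qed (use assms in simp)

theorem extension_exists:
  "\<exists>u. valuation E (carrier E) u \<and> extends_valuation K v u \<and> S \<subseteq> nonneg_part (carrier E) u"
proof (intro exI conjI)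
  let ?u = "\<lambda>x. if x = \<zero> then top.Top else top.Value (u_val x)"
  show "valuation E (carrier E) ?u"
    unfolding valuation_def
  proof (intro conjI ballI)
    fix x y assume xy: "x \<in> carrier E" "y \<in> carrier E"
    show "?u (x \<otimes> y) = ?u x + ?u y"
      using xy by (auto simp: u_val_mult)
    show "min (?u x) (?u y) \<le> ?u (x \<oplus> y)"
      using xy u_val_add [of x y] by (auto simp: min_le_iff_disj)
  qed simp
  show "extends_valuation K v ?u"
    by (auto simp: extends_valuation_def v_eq_val u_val_K)
  show "S \<subseteq> nonneg_part (carrier E) ?u"
    using u_val_nonneg by (auto simp: nonneg_part_def zero_top_def)
qed

end

section \<open>The filter quasi-valuation\<close>

locale filter_extension = valued_extension E F v R
  for E :: "('a, 'e) ring_scheme" (structure) and F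
    and v :: "'a \<Rightarrow> 'g::linordered_ab_group_add top" and R +
  assumes algebraic: "x \<in> carrier E \<Longrightarrow> (algebraic over F) x"
    and fraction_field: "is_fraction_field_of E R"
begin

abbreviation w_ring :: "'a \<Rightarrow> 'g cut top" where
  "w_ring \<equiv> filter_qv_ring E F R v"

abbreviation w :: "'a \<Rightarrow> 'g cut top" where
  "w \<equiv> filter_quasi_valuation E F R v"

section \<open>Fractions with denominators from the valuation ring of v\<close>

lemma O_mult: "s \<in> O\<^sub>v \<Longrightarrow> t \<in> O\<^sub>v \<Longrightarrow> s \<otimes> t \<in> O\<^sub>v"
  using subringE(6) [OF O_subring] by blast

lemma O_F: "s \<in> O\<^sub>v \<Longrightarrow> s \<in> F"
  by (simp add: mem_O_iff)

lemma one_O: "\<one> \<in> O\<^sub>v"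
  by (simp add: mem_O_iff)

text \<open>The localization of \<open>R\<close> at the nonzero elements of
  \<open>O\<^sub>v\<close>. It turns out to be all of \<open>E\<close>: it is closed under sums and
  products and contains \<open>R\<close>, \<open>F\<close> and the inverses of the nonzero elements
  of \<open>R\<close>.\<close>

definition fractions :: "'a set" where
  "fractions = {y \<in> carrier E. \<exists>s\<in>O\<^sub>v - {\<zero>}. s \<otimes> y \<in> R}"

lemma fractionsI: "y \<in> carrier E \<Longrightarrow> s \<in> O\<^sub>v \<Longrightarrow> s \<noteq> \<zero> \<Longrightarrow> s \<otimes> y \<in> R \<Longrightarrow> y \<in> fractions"
  by (auto simp: fractions_def)

lemma fractionsE:
  assumes "y \<in> fractions"
  obtains s where "y \<in> carrier E" "s \<in> O\<^sub>v" "s \<noteq> \<zero>" "s \<otimes> y \<in> R"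
  using assms by (auto simp: fractions_def)

lemma R_fractions: "y \<in> R \<Longrightarrow> y \<in> fractions"
  by (rule fractionsI [of _ \<one>]) (simp_all add: one_O)

lemma F_fractions:
  assumes "y \<in> F"
  shows "y \<in> fractions"
proof (cases "y \<in> O\<^sub>v")
  case True
  then show ?thesis
    by (intro R_fractions O_S)
next
  case False
  then have "y \<noteq> \<zero>" "inv y \<in> O\<^sub>v"
    using assms by (auto simp: mem_O_iff val_inv)
  then show ?thesis
    using assms by (intro fractionsI [of _ "inv y"]) auto
qed

lemma fractions_add_mult:
  assumes "y \<in> fractions" "z \<in> fractions"
  shows "y \<oplus> z \<in> fractions" "y \<otimes> z \<in> fractions"
proof -
  obtain s where s: "y \<in> carrier E" "s \<in> O\<^sub>v" "s \<noteq> \<zero>" "s \<otimes> y \<in> R"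
    using assms(1) by (rule fractionsE)
  obtain t where t: "z \<in> carrier E" "t \<in> O\<^sub>v" "t \<noteq> \<zero>" "t \<otimes> z \<in> R"
    using assms(2) by (rule fractionsE)
  have st: "s \<otimes> t \<in> O\<^sub>v" "s \<otimes> t \<noteq> \<zero>"
    using s t by (simp_all add: O_mult O_F)
  have "(s \<otimes> t) \<otimes> (y \<oplus> z) = t \<otimes> (s \<otimes> y) \<oplus> s \<otimes> (t \<otimes> z)"
    using s t by (simp add: O_F r_distr m_ac)
  also have "\<dots> \<in> R"
    using s t by (simp add: O_S)
  finally show "y \<oplus> z \<in> fractions"
    using s t st by (intro fractionsI [of _ "s \<otimes> t"]) auto
  have "(s \<otimes> t) \<otimes> (y \<otimes> z) = (s \<otimes> y) \<otimes> (t \<otimes> z)"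
    using s t by (simp add: O_F m_ac)
  also have "\<dots> \<in> R"
    using s t by simp
  finally show "y \<otimes> z \<in> fractions"
    using s t st by (intro fractionsI [of _ "s \<otimes> t"]) auto
qed

lemma eval_fractions:
  assumes x: "x \<in> fractions" and "set p \<subseteq> F"
  shows "eval p x \<in> fractions"
  using assms(2)
proof (induction p)
  case Nil
  show ?case
    by (simp add: F_fractions)
next
  case (Cons a p)
  have pow: "x [^] n \<in> fractions" for n :: nat
    by (induction n) (simp_all add: F_fractions x fractions_add_mult(2))
  have "a \<otimes> x [^] length p \<oplus> eval p x \<in> fractions"
    using Cons pow by (intro fractions_add_mult) (auto simp: F_fractions)
  then show ?case
    by simp
qed

text \<open>Write the equation for b as y b + c = 0, with y a polynomial in b over \<open>F\<close>.
  If c is nonzero, the inverse of b is -y/c; otherwise b cancels and y = 0 is a shorter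
  equation.\<close>

lemma inv_fractions_of_root:
  assumes b: "b \<in> R" "b \<noteq> \<zero>" and "set p \<subseteq> F" "\<not> set p \<subseteq> {\<zero>}" "eval p b = \<zero>"
  shows "inv b \<in> fractions"
  using assms(3-5)
\<comment> \<open>Coefficient lists start with the leading coefficient, so the constant term is
  split off at the end.\<close>
proof (induction p rule: rev_induct)
  case (snoc c p)
  have p: "set p \<subseteq> F" "set p \<subseteq> carrier E" and c: "c \<in> F"
    using snoc.prems(1) by auto
  define y where "y = eval p b"
  have y: "y \<in> carrier E" "y \<in> fractions"
    unfolding y_def using b p by (simp_all add: eval_in_carrier eval_fractions R_fractions)
  have eq: "y \<otimes> b \<oplus> c = \<zero>"
    using eval_append_aux [OF p(2), of c b] snoc.prems(3) b c by (simp add: y_def)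
  show ?case
  proof (cases "c = \<zero>")
    case True
    then have "y = \<zero>"
      using eq b y by simp
    then show ?thesis
      using snoc.IH snoc.prems p True by (auto simp: y_def)
  next
    case False
    have yb: "y \<otimes> b = \<ominus> c"
      using minus_equality [OF eq] y b c by simp
    have "b \<otimes> (\<ominus> (inv c) \<otimes> y) = \<ominus> (inv c) \<otimes> (y \<otimes> b)"
      using y b c False by (simp add: m_ac)
    also have "\<dots> = \<one>"
      unfolding yb using c False by (simp add: l_minus r_minus)
    finally have "b \<otimes> (\<ominus> (inv c) \<otimes> y) = \<one>" .
    then have "inv b = \<ominus> (inv c) \<otimes> y"
      using y b c False by (intro comm_inv_char) auto
    moreover have "\<ominus> (inv c) \<otimes> y \<in> fractions"
      using y(2) c False by (simp add: fractions_add_mult(2) F_fractions)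
    ultimately show ?thesis
      by simp
  qed
qed simp

lemma inv_fractions:
  assumes b: "b \<in> R" "b \<noteq> \<zero>"
  shows "inv b \<in> fractions"
proof -
  have "b \<in> carrier E"
    using b by simp
  then obtain p where p: "p \<in> carrier (F[X])" "p \<noteq> []" "eval p b = \<zero>"
    using algebraicE [OF subfieldE(1) [OF K] _ algebraic] by blast
  have "set p \<subseteq> F" and "lead_coeff p \<noteq> \<zero>"
    using p(1,2) unfolding univ_poly_carrier [symmetric] polynomial_def by auto
  moreover from this have "\<not> set p \<subseteq> {\<zero>}"
    using hd_in_set [OF p(2)] by blast
  ultimately show ?thesis
    using inv_fractions_of_root [OF b] p(3) by blast
qed

lemma fraction_exists:
  assumes "x \<in> carrier E"
  shows "\<exists>r\<in>R. \<exists>s\<in>O\<^sub>v - {\<zero>}. x = r \<otimes> inv s"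
proof -
  obtain a b where ab: "a \<in> R" "b \<in> R" "b \<noteq> \<zero>" "x = a \<otimes> inv b"
    using fraction_field assms unfolding is_fraction_field_of_def by blast
  then have "x \<in> fractions"
    by (simp add: fractions_add_mult R_fractions inv_fractions)
  then obtain s where s: "s \<in> O\<^sub>v" "s \<noteq> \<zero>" "s \<otimes> x \<in> R"
    by (rule fractionsE)
  have "x = (s \<otimes> x) \<otimes> inv s"
    using s(1,2) assms by (simp add: O_F m_comm)
  then show ?thesis
    using s by blast
qed

section \<open>The cut of an element and independence of the chosen fraction\<close>

lemma divisor_set_iff:
  "a \<in> divisor_set E F R v x \<longleftrightarrow> a \<in> O\<^sub>v \<and> (\<exists>h\<in>R. x = a \<otimes> h)"
  by (auto simp: divisor_set_def l_coset_def)

lemma one_divisor: "r \<in> R \<Longrightarrow> \<one> \<in> divisor_set E F R v r"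
  by (auto simp: divisor_set_iff one_O intro!: bexI [of _ r])

lemma divisor_nonzero: "a \<in> divisor_set E F R v x \<Longrightarrow> x \<noteq> \<zero> \<Longrightarrow> a \<noteq> \<zero>"
  by (auto simp: divisor_set_iff)

definition divisor_cut :: "'a \<Rightarrow> 'g cut" where
  "divisor_cut x = cut_above {\<gamma>. top.Value \<gamma> \<in> v ` divisor_set E F R v x}"

lemma w_ring_eq: "x \<noteq> \<zero> \<Longrightarrow> w_ring x = top.Value (divisor_cut x)"
  by (simp add: filter_qv_ring_def divisor_cut_def)

lemma lower_divisor_cut:
  assumes "x \<noteq> \<zero>"
  shows "\<alpha> \<in> cut_lower (divisor_cut x) \<longleftrightarrow> (\<exists>a\<in>divisor_set E F R v x. \<alpha> \<le> val a)"
proof -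
  have "v a = top.Value (val a)" if "a \<in> divisor_set E F R v x" for a
    using that divisor_nonzero [OF that assms] by (simp add: v_eq_val divisor_set_iff O_F)
  then show ?thesis
    unfolding divisor_cut_def lower_cut_above by (force simp: image_iff)
qed

text \<open>If v(s) \<le> v(a), then c = a/s lies in \<open>O\<^sub>v\<close> and divides r with the
  same cofactor h. Otherwise c = 1 already suffices.\<close>

lemma divisor_of_mult:
  assumes r: "r \<in> R" "r \<noteq> \<zero>" and s: "s \<in> O\<^sub>v" "s \<noteq> \<zero>"
    and a: "a \<in> divisor_set E F R v (r \<otimes> s)"
  shows "\<exists>c\<in>divisor_set E F R v r. val a \<le> val c + val s"
proof (cases "val s \<le> val a")
  case True
  obtain h where h: "a \<in> O\<^sub>v" "h \<in> R" "r \<otimes> s = a \<otimes> h"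
    using a by (auto simp: divisor_set_iff)
  have "a \<noteq> \<zero>"
    using divisor_nonzero [OF a] r s by (simp add: O_F)
  have F: "a \<in> F" "s \<in> F"
    using h s by (simp_all add: O_F)
  define c where "c = inv s \<otimes> a"
  have c: "c \<in> O\<^sub>v" "val a = val c + val s"
    using F s(2) \<open>a \<noteq> \<zero>\<close> True by (simp_all add: c_def mem_O_iff val_mult val_inv)
  have "r = inv s \<otimes> (r \<otimes> s)"
    using F r s(2) by (simp add: m_comm [of r s])
  then have "r = c \<otimes> h"
    using F r h(2) s(2) by (simp add: c_def h(3) m_assoc)
  then have "c \<in> divisor_set E F R v r"
    using c h(2) by (auto simp: divisor_set_iff)
  then show ?thesis
    using c by auto
next
  case False
  then show ?thesis
    using one_divisor [OF r(1)] by (intro bexI [of _ \<one>]) auto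
qed

text \<open>This is what makes w(r/s) independent of the fraction. One inclusion is
  \<open>divisor_of_mult\<close>; for the other, a divisor of r times s divides r s.\<close>

lemma divisor_cut_mult:
  assumes r: "r \<in> R" "r \<noteq> \<zero>" and s: "s \<in> O\<^sub>v" "s \<noteq> \<zero>"
  shows "divisor_cut (r \<otimes> s) = divisor_cut r + point_cut (val s)"
proof (rule cut_eqI, rule Set.set_eqI)
  fix \<alpha>
  have rs: "r \<otimes> s \<noteq> \<zero>"
    using r s by (simp add: O_F)
  show "\<alpha> \<in> cut_lower (divisor_cut (r \<otimes> s)) \<longleftrightarrow>
      \<alpha> \<in> cut_lower (divisor_cut r + point_cut (val s))"
  proof
    assume "\<alpha> \<in> cut_lower (divisor_cut (r \<otimes> s))"
    then obtain a where a: "a \<in> divisor_set E F R v (r \<otimes> s)" "\<alpha> \<le> val a"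
      using lower_divisor_cut [OF rs] by blast
    then obtain c where c: "c \<in> divisor_set E F R v r" "val a \<le> val c + val s"
      using divisor_of_mult [OF r s] by blast
    have "\<alpha> - val s \<le> val c"
      using a(2) c(2) by (simp add: diff_le_eq)
    then have "\<alpha> - val s \<in> cut_lower (divisor_cut r)"
      using c(1) lower_divisor_cut [OF r(2)] by blast
    then show "\<alpha> \<in> cut_lower (divisor_cut r + point_cut (val s))"
      unfolding lower_plus lower_point_cut
      by (intro CollectI exI [of _ "\<alpha> - val s"] exI [of _ "val s"]) simp
  next
    assume "\<alpha> \<in> cut_lower (divisor_cut r + point_cut (val s))"
    then obtain \<beta> \<gamma> where \<beta>: "\<alpha> = \<beta> + \<gamma>" "\<beta> \<in> cut_lower (divisor_cut r)" "\<gamma> \<le> val s"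
      unfolding lower_plus lower_point_cut by blast
    then obtain a where a: "a \<in> divisor_set E F R v r" "\<beta> \<le> val a"
      using lower_divisor_cut [OF r(2)] by blast
    then obtain h where h: "a \<in> O\<^sub>v" "h \<in> R" "r = a \<otimes> h"
      by (auto simp: divisor_set_iff)
    have "a \<noteq> \<zero>"
      using divisor_nonzero [OF a(1) r(2)] .
    have "r \<otimes> s = (a \<otimes> s) \<otimes> h"
      using h s by (simp add: O_F m_ac)
    then have "a \<otimes> s \<in> divisor_set E F R v (r \<otimes> s)"
      unfolding divisor_set_iff using h(1,2) s by (blast intro: O_mult)
    moreover have "\<alpha> \<le> val (a \<otimes> s)"
      using \<beta> a h(1) s \<open>a \<noteq> \<zero>\<close> by (simp add: val_mult O_F add_mono)
    ultimately show "\<alpha> \<in> cut_lower (divisor_cut (r \<otimes> s))"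
      using lower_divisor_cut [OF rs] by blast
  qed
qed

text \<open>Cross-multiplication gives r s' = r' s, to which \<open>divisor_cut_mult\<close> applies
  on both sides; the values of s and s' are then moved across.\<close>

lemma w_ring_cong:
  assumes r: "r \<in> R" and s: "s \<in> O\<^sub>v" "s \<noteq> \<zero>" and r': "r' \<in> R" and s': "s' \<in> O\<^sub>v" "s' \<noteq> \<zero>"
    and eq: "r \<otimes> inv s = r' \<otimes> inv s'"
  shows "w_ring r + top.Value (point_cut (- val s)) = w_ring r' + top.Value (point_cut (- val s'))"
proof -
  have F: "s \<in> F" "s' \<in> F"
    using s s' by (simp_all add: O_F)
  have "r \<otimes> s' = (r \<otimes> inv s) \<otimes> (s \<otimes> s')"
    using r s s' F by (simp add: m_assoc)
  also have "\<dots> = r' \<otimes> (inv s' \<otimes> (s' \<otimes> s))"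
    unfolding eq using r' s s' F by (simp add: m_assoc m_comm [of s s'])
  also have "\<dots> = r' \<otimes> s"
    using r' s s' F by simp
  finally have cross: "r \<otimes> s' = r' \<otimes> s" .
  show ?thesis
  proof (cases "r = \<zero>")
    case True
    then have "r' \<otimes> s = \<zero>"
      using cross F by simp
    then have "r' = \<zero>"
      using r' s(2) F by simp
    with True show ?thesis
      by (simp add: filter_qv_ring_def)
  next
    case False
    then have "r' \<noteq> \<zero>"
      using cross r s' s F by (metis K_carrier S_carrier l_null m_eq_zero_iff)
    \<comment> \<open>The cut monoid is not cancellative, but a point cut is invertible, with the
      point cut of the negative as its inverse.\<close>
    have cancel: "A + point_cut \<beta> + (point_cut (- \<alpha>) + point_cut (- \<beta>)) = A + point_cut (- \<alpha>)"
      for A :: "'g cut" and \<alpha> \<beta>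
    proof -
      have "point_cut \<beta> + (point_cut (- \<alpha>) + point_cut (- \<beta>)) = point_cut (- \<alpha>)"
        by (simp flip: point_cut_add)
      then show ?thesis
        by (simp add: add.assoc)
    qed
    have "divisor_cut r + point_cut (val s') = divisor_cut r' + point_cut (val s)"
      using divisor_cut_mult [OF r False s'] divisor_cut_mult [OF r' \<open>r' \<noteq> \<zero>\<close> s] cross by simp
    then have "divisor_cut r + point_cut (- val s) = divisor_cut r' + point_cut (- val s')"
      using cancel [of "divisor_cut r" "val s'" "val s"] cancel [of "divisor_cut r'" "val s" "val s'"]
      by (simp add: add.commute)
    then show ?thesis
      using False \<open>r' \<noteq> \<zero>\<close> by (simp add: w_ring_eq)
  qed
qed

lemma w_fraction:
  assumes r: "r \<in> R" and s: "s \<in> O\<^sub>v" "s \<noteq> \<zero>"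
  shows "w (r \<otimes> inv s) = w_ring r + top.Value (point_cut (- val s))"
  unfolding filter_quasi_valuation_def
proof (rule the_equality)
  show "\<exists>r'\<in>R. \<exists>s'\<in>O\<^sub>v - {\<zero>}. \<exists>\<gamma>. r \<otimes> inv s = r' \<otimes> inv s' \<and> v s' = top.Value \<gamma> \<and>
      w_ring r + top.Value (point_cut (- val s)) = w_ring r' + top.Value (point_cut (- \<gamma>))"
    using r s v_eq_val [OF O_F [OF s(1)] s(2)] by blast
next
  fix m
  assume "\<exists>r'\<in>R. \<exists>s'\<in>O\<^sub>v - {\<zero>}. \<exists>\<gamma>. r \<otimes> inv s = r' \<otimes> inv s' \<and> v s' = top.Value \<gamma> \<and>
      m = w_ring r' + top.Value (point_cut (- \<gamma>))"
  then obtain r' s' \<gamma> where *: "r' \<in> R" "s' \<in> O\<^sub>v" "s' \<noteq> \<zero>" "r \<otimes> inv s = r' \<otimes> inv s'"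
      "v s' = top.Value \<gamma>" "m = w_ring r' + top.Value (point_cut (- \<gamma>))"
    by blast
  moreover have "\<gamma> = val s'"
    using v_eq_val [OF O_F [OF *(2)] *(3)] *(5) by simp
  ultimately show "m = w_ring r + top.Value (point_cut (- val s))"
    using w_ring_cong [OF r s *(1-4)] by simp
qed

section \<open>Comparison of w with the extensions of v\<close>

lemma w_nonneg:
  assumes "r \<in> R"
  shows "0 \<le> w r"
proof (cases "r = \<zero>")
  case True
  then show ?thesis
    using w_fraction [OF assms one_O] by (simp add: filter_qv_ring_def)
next
  case False
  have "w r = top.Value (divisor_cut r)"
    using w_fraction [OF assms one_O] assms False by (simp add: w_ring_eq flip: zero_cut_def)
  \<comment> \<open>The element 1 belongs to the divisor set of every r in \<open>R\<close> and has
    value 0.\<close>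
  moreover have "0 \<le> divisor_cut r"
    unfolding zero_cut_def less_eq_cut_def lower_point_cut
    using lower_divisor_cut [OF False] one_divisor [OF assms] val_one by (metis atMost_iff subsetI)
  ultimately show ?thesis
    by (simp add: zero_top_def)
qed

lemma w_le_extension:
  fixes u :: "'a \<Rightarrow> 'g div_hull top"
  assumes u: "valuation E (carrier E) u" "extends_valuation F v u"
    and R: "R \<subseteq> nonneg_part (carrier E) u" and x: "x \<in> carrier E"
  shows "map_top to_div_hull (w x) \<le> map_top div_point_cut (u x)"
proof (cases "x = \<zero>")
  case True
  then have "u x = top.Top"
    using u(1) x by (simp add: valuation_def)
  then show ?thesis
    by simp
next
  case False
  \<comment> \<open>Regarding \<open>E\<close> as a subfield of itself makes the arithmetic of
    \<open>val\<close> available for u.\<close>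
  interpret U: valued_field E "carrier E" u
    by (intro valued_field.intro valued_field_axioms.intro field_axioms carrier_is_subfield u(1))
  have ext: "U.val a = to_div_hull (val a)" if "a \<in> F" "a \<noteq> \<zero>" for a
  proof -
    have "u a = map_top to_div_hull (v a)"
      using u(2) that(1) by (simp add: extends_valuation_def)
    then show ?thesis
      using v_eq_val [OF that] U.v_eq_val [OF K_carrier [OF that(1)] that(2)] by simp
  qed
  obtain r s where rs: "r \<in> R" "s \<in> O\<^sub>v" "s \<noteq> \<zero>" "x = r \<otimes> inv s"
    using fraction_exists [OF x] by blast
  have s: "s \<in> F"
    using rs by (simp add: O_F)
  have r: "r \<noteq> \<zero>"
    using False rs s by auto
  have le: "to_div_hull \<alpha> \<le> U.val r" if \<alpha>: "\<alpha> \<in> cut_lower (divisor_cut r)" for \<alpha>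
  proof -
    obtain a h where a: "\<alpha> \<le> val a" "a \<in> O\<^sub>v" "h \<in> R" "r = a \<otimes> h"
      using \<alpha> lower_divisor_cut [OF r] by (auto simp: divisor_set_iff)
    have nz: "a \<noteq> \<zero>" "h \<noteq> \<zero>"
      using a r by (auto simp: O_F)
    have "0 \<le> U.val h"
      using R a(3) nz by (auto simp: U.mem_O_iff)
    moreover have "U.val r = to_div_hull (val a) + U.val h"
      using a nz ext [OF O_F [OF a(2)] nz(1)] by (simp add: U.val_mult O_F)
    moreover have "to_div_hull \<alpha> \<le> to_div_hull (val a)"
      using a(1) by simp
    ultimately show ?thesis
      by (metis add.right_neutral add_mono)
  qed
  \<comment> \<open>A point below w(x) is \<beta> + \<gamma> with \<beta> below w(r) and \<gamma>
    \<le> -v(s); bounding the summands separately gives u(r) - v(s) = u(x).\<close>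
  have "to_div_hull (divisor_cut r + point_cut (- val s)) \<le> div_point_cut (U.val x)"
  proof (rule to_div_hull_le_div_point_cut)
    fix \<alpha> assume "\<alpha> \<in> cut_lower (divisor_cut r + point_cut (- val s))"
    then obtain \<beta> \<gamma> where \<beta>: "\<alpha> = \<beta> + \<gamma>" "\<beta> \<in> cut_lower (divisor_cut r)" "\<gamma> \<le> - val s"
      unfolding lower_plus lower_point_cut by blast
    have "to_div_hull \<alpha> \<le> U.val r + to_div_hull (- val s)"
      unfolding \<beta>(1) to_div_hull_add using le [OF \<beta>(2)] \<beta>(3) by (intro add_mono) simp_all
    also have "\<dots> = U.val x"
      unfolding rs(4) using rs r s ext [OF s rs(3)]
      by (simp add: U.val_mult U.val_inv to_div_hull_minus)
    finally show "to_div_hull \<alpha> \<le> U.val x" .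
  qed
  then show ?thesis
    using w_fraction [OF rs(1-3)] rs(4) U.v_eq_val [OF x False] r by (simp add: w_ring_eq)
qed

text \<open>Passes from the ring \<open>R\<close> to the nonnegative part of w: there 0 \<le> w(x)
  \<le> u(x) in the hull of the cut monoid, and the embedding of the hull of the group reflects the
  order.\<close>

lemma nonneg_w_subset:
  fixes u :: "'a \<Rightarrow> 'g div_hull top"
  assumes u: "valuation E (carrier E) u" "extends_valuation F v u"
    and R: "R \<subseteq> nonneg_part (carrier E) u"
  shows "nonneg_part (carrier E) w \<subseteq> nonneg_part (carrier E) u"
proof
  fix x assume "x \<in> nonneg_part (carrier E) w"
  then have x: "x \<in> carrier E" "0 \<le> w x"
    by (auto simp: nonneg_part_def)
  have le: "map_top to_div_hull (w x) \<le> map_top div_point_cut (u x)"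
    using w_le_extension [OF u R x(1)] .
  have "0 \<le> u x"
  proof (cases "u x")
    case (Value q)
    then obtain A where A: "w x = top.Value A" "to_div_hull A \<le> div_point_cut q"
      using le by (cases "w x") auto
    \<comment> \<open>Both embeddings send 0 to the same element of the hull of the cut monoid, so 0
      \<le> u(x) can be tested there.\<close>
    have "div_point_cut (to_div_hull 0) = to_div_hull (0 :: 'g cut)"
      unfolding div_point_cut_to_div_hull zero_cut_def ..
    also have "\<dots> \<le> to_div_hull A"
      using x(2) A(1) by (simp add: zero_top_def del: to_div_hull_0)
    also note A(2)
    finally have "0 \<le> q"
      by (simp del: to_div_hull_0 flip: to_div_hull_0)
    then show ?thesis
      by (simp add: Value zero_top_def)
  qed simp
  then show "x \<in> nonneg_part (carrier E) u"
    using x by (simp add: nonneg_part_def)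
qed

lemma dominating_extension_exists:
  "\<exists>u :: 'a \<Rightarrow> 'g div_hull top.
     valuation E (carrier E) u \<and> extends_valuation F v u \<and> R \<subseteq> nonneg_part (carrier E) u"
proof -
  obtain S' where S': "subring S' E" "R \<subseteq> S'" "S' \<inter> F = O\<^sub>v"
    "\<And>T. subring T E \<Longrightarrow> S' \<subseteq> T \<Longrightarrow> T \<inter> F = O\<^sub>v \<Longrightarrow> T = S'"
    using maximal_subring_exists [OF S S_K] by blast
  interpret M: maximal_valued_extension E F v S'
    using S' by (intro maximal_valued_extension.intro valued_extension.intro
        valued_extension_axioms.intro maximal_valued_extension_axioms.intro valued_field_axioms) auto
  interpret A: algebraic_valuation_ring E F v S'
    using M.mem_or_inv_mem algebraic
    by (intro algebraic_valuation_ring.intro algebraic_valuation_ring_axioms.intro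
        M.valued_extension_axioms) auto
  show ?thesis
    using A.extension_exists S'(2) by blast
qed

end

theorem theorem10p5:
  fixes E :: "('a, 'b) ring_scheme"
    and F R :: "'a set"
    and v :: "'a \<Rightarrow> 'g::linordered_ab_group_add top"
    and w :: "'a \<Rightarrow> 'g cut top"
  assumes "field E"
    and "subfield F E"
    and "ring.finite_dimension E F (carrier E)"
    and "valuation E F v"
    and "value_group E F v = UNIV"
    and "subring R E"
    and "is_fraction_field_of E R"
    and "R \<inter> F = nonneg_part F v"
    and "w = filter_quasi_valuation E F R v"
  shows "(\<exists>u :: 'a \<Rightarrow> 'g div_hull top.
            valuation E (carrier E) u \<and> extends_valuation F v u \<and>
            nonneg_part (carrier E) w \<subseteq> nonneg_part (carrier E) u) \<and>
         (\<forall>u :: 'a \<Rightarrow> 'g div_hull top.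
            valuation E (carrier E) u \<longrightarrow> extends_valuation F v u \<longrightarrow>
            nonneg_part (carrier E) w \<subseteq> nonneg_part (carrier E) u \<longrightarrow>
            (\<forall>x\<in>carrier E. map_top to_div_hull (w x) \<le> map_top div_point_cut (u x)))"
proof -
  interpret field E by fact
  interpret filter_extension E F v R
  proof (intro filter_extension.intro filter_extension_axioms.intro valued_extension.intro
      valued_extension_axioms.intro valued_field.intro valued_field_axioms.intro assms)
    fix x assume "x \<in> carrier E"
    then show "(algebraic over F) x"
      using finite_dimension_imp_algebraic assms(2,3) carrier_is_subring by blast
  qed
  \<comment> \<open>Hence any u that is nonnegative on the nonnegative part of w is nonnegative on
    \<open>R\<close>, as \<open>w_le_extension\<close> requires.\<close>
  have "R \<subseteq> nonneg_part (carrier E) w"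
    using w_nonneg by (auto simp: nonneg_part_def assms(9))
  then show ?thesis
    using dominating_extension_exists nonneg_w_subset w_le_extension unfolding assms(9)
    by (meson subset_trans)
qed

end
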